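(* Let $q\in[1,+\infty]$. Suppose: (i) for each $z\in\mathcal Z$, $c(z,\cdot)$ is Lipschitz continuous on $\mathcal Y$ with Lipschitz constant $L(z)$ satisfying $\sup_{z\in\mathcal Z}L(z)<+\infty$; (ii) there is a constant $0<r\le1$ such that $$\|f^*(X)-\hat f_n(X)\|_{L^q}=O_p(n^{-r/2}),\qquad \tfrac1n\sum_{i=1}^n\|f^*(x^i)-\hat f_n(x^i)\|^2=O_p(n^{-r});$$ (iii) $$\Big\|\sup_{z\in\mathcal Z}\Big(\tfrac1n\sum_{i=1}^n(c(z,f^*(X)+\varepsilon^i))^2\Big)^{1/2}\Big\|_{L^q}=O_p(1),\qquad \Big\|\sup_{z\in\mathcal Z}|g^*_n(z;X)-g(z;X)|\Big\|_{L^q}=O_p(n^{-1/2});$$ (iv) with this $r$, the radius $\zeta_n(x)$ is chosen such that $\sup_{x\in\mathcal X}\sup_{p\in\mathfrak P_n(x;\zeta_n(x))}\sum_{i=1}^n(p_i-\frac1n)^2=O(n^{-(1+r)})$, and the radius $\mu_n(x)$ satisfies $\|\mu_n(X)\|_{L^q}=O(n^{-r/2})$. Then the optimal value $\hat v^{DRO}_n$ and solution $\hat z^{DRO}_n$ of the ER-DRO problem satisfy $$\|\hat v^{DRO}_n(X)-v^*(X)\|_{L^q}=O_p(n^{-r/2}),\qquad \|g(\hat z^{DRO}_n(X);X)-v^*(X)\|_{L^q}=O_p(n^{-r/2}).$$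
   Context: Setup. $Y=f^*(X)+\varepsilon$, where $X$ is a random vector with support $\mathcal X\subseteq\mathbb R^{d_x}$ and distribution $P_X$, $Y$ has nonempty convex support $\mathcal Y\subseteq\mathbb R^{d_y}$, $f^*(x):=\mathbb E[Y\mid X=x]$, and the zero-mean error $\varepsilon$ is independent of $X$. "A.e. $x$" is with respect to $P_X$. $\|\cdot\|$ is the Euclidean norm; $\|\cdot\|_{L^q}$ is the $L^q$-norm of functions of $X$ with respect to $P_X$ (for a fixed realization of the data when the function depends on the data). $\mathcal Z\subseteq\mathbb R^{d_z}$ is nonempty and compact, $c:\mathcal Z\times\mathcal Y\to\mathbb R$, $\mathbb E|c(z,f^*(x)+\varepsilon)|<\infty$ for each $z\in\mathcal Z$ and a.e. $x$, and $g(z;x):=\mathbb E[c(z,f^*(x)+\varepsilon)]$ is lower semicontinuous in $z$ on $\mathcal Z$ for a.e. $x$. The true problem is $v^*(x):=\min_{z\in\mathcal Z}g(z;x)$. All functions, sets and selections are assumed measurable. Data. $\mathcal D_n=\{(y^i,x^i)\}_{i=1}^n$ are joint observations of $(Y,X)$, $\varepsilon^i:=y^i-f^*(x^i)$; $\hat f_n$ is an estimate of $f^*$ built from $\mathcal D_n$ by a regression method, with residuals $\hat\varepsilon^i_n:=y^i-\hat f_n(x^i)$. $O_p$ refers to the data: $V_n=O_p(W_n)$ means $V_n=R_nW_n$ with $\{R_n\}$ bounded in probability. $g^*_n(z;x):=\frac1n\sum_{i=1}^nc(z,f^*(x)+\varepsilon^i)$. $\mathrm{proj}_{\mathcal Y}$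 is the orthogonal projection onto $\mathcal Y$. Ambiguity set. For nonnegative radii $\mu_n(x),\zeta_n(x)$, $$\hat{\mathcal P}_n(x):=\Big\{Q=\sum_{i=1}^np_i\delta_{\bar y^i}: p\in\mathfrak P_n(x;\zeta_n(x)),\ \bar y^i\in\hat{\mathcal Y}^i_n(x;\mu_n(x)),\ i=1,\dots,n\Big\},$$ $$\hat{\mathcal Y}^i_n(x;\mu):=\{y\in\mathcal Y:\|y-\mathrm{proj}_{\mathcal Y}(\hat f_n(x)+\hat\varepsilon^i_n)\|\le\mu\},$$ where $\delta$ is the Dirac measure and $\mathfrak P_n(x;\zeta)\subseteq\mathbb R^n$ is a given family of sets of probability vectors ($p\ge0$, $\sum_ip_i=1$ for all $p\in\mathfrak P_n(x;\zeta)$) with $\lim_{\zeta\downarrow0}\mathfrak P_n(x;\zeta)=\mathfrak P_n(x;0)=\{(\frac1n,\dots,\frac1n)\}$ for each $x$. ER-DRO problem. $\hat v^{DRO}_n(x)=\min_{z\in\mathcal Z}\sup_{Q\in\hat{\mathcal P}_n(x)}\mathbb E_{Y\sim Q}[c(z,Y)]$, with optimal solution $\hat z^{DRO}_n(x)$; its objective is assumed real-valued and lower semicontinuous on $\mathcal Z$ for each $x$. *)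

theory Defs
  imports "HOL-Probability.Probability"
begin

definition topological_support :: "'a::topological_space measure \<Rightarrow> 'a set" where
  "topological_support N = {x. \<forall>U. open U \<and> x \<in> U \<longrightarrow> emeasure N U > 0}"

definition lsc_on :: "'a::topological_space set \<Rightarrow> ('a \<Rightarrow> ereal) \<Rightarrow> bool" where
  "lsc_on S F \<longleftrightarrow> (\<forall>x\<in>S. F x \<le> Liminf (at x within S) F)"

text \<open>The optimal value as a real number. For a real-valued lower semicontinuous objective on a
  nonempty compact set the infimum is a finite minimum.\<close>

definition min_value :: "'a set \<Rightarrow> ('a \<Rightarrow> ereal) \<Rightarrow> real" where
  "min_value S F = real_of_ereal (INF z\<in>S. F z)"

text \<open>Painleve--Kuratowski convergence of sets: the outer and the inner limit both equal \<open>L\<close>.\<close>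

definition set_limit :: "('i \<Rightarrow> 'a::topological_space set) \<Rightarrow> 'a set \<Rightarrow> 'i filter \<Rightarrow> bool" where
  "set_limit S L F \<longleftrightarrow>
     {p. \<forall>U. open U \<and> p \<in> U \<longrightarrow> (\<exists>\<^sub>F t in F. S t \<inter> U \<noteq> {})} = L \<and>
     {p. \<forall>U. open U \<and> p \<in> U \<longrightarrow> (\<forall>\<^sub>F t in F. S t \<inter> U \<noteq> {})} = L"

text \<open>The norm is applied to \<open>[0,\<infinity>]\<close>-valued functions, so that the suprema and the norms below
  are never truncated when they are infinite.\<close>

definition ennreal_powr :: "ennreal \<Rightarrow> real \<Rightarrow> ennreal" where
  "ennreal_powr t a = (if t = \<infinity> then \<infinity> else ennreal (enn2real t powr a))"

definition Lq_norm :: "ennreal \<Rightarrow> 'a measure \<Rightarrow> ('a \<Rightarrow> ennreal) \<Rightarrow> ennreal" where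
  "Lq_norm q N h =
     (if q = \<infinity> then esssup N h
      else ennreal_powr (\<integral>\<^sup>+ x. ennreal_powr (h x) (enn2real q) \<partial>N) (1 / enn2real q))"

definition big_O :: "(nat \<Rightarrow> ennreal) \<Rightarrow> (nat \<Rightarrow> real) \<Rightarrow> bool" where
  "big_O V W \<longleftrightarrow> (\<exists>C::real. \<forall>\<^sub>F n in sequentially. V n \<le> ennreal (C * W n))"

text \<open>Both \<open>O\<close> and \<open>O\<^sub>p\<close> are read as \<open>n \<rightarrow> \<infinity>\<close>: finitely many indices, where an
  \<open>L\<^sup>q\<close>-norm may be infinite, are ignored.\<close>

definition bounded_in_probability :: "'w measure \<Rightarrow> (nat \<Rightarrow> 'w \<Rightarrow> ennreal) \<Rightarrow> bool" where
  "bounded_in_probability M R \<longleftrightarrow>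
     (\<forall>n. R n \<in> borel_measurable M) \<and>
     (\<forall>\<delta>>0. \<exists>K::real. \<forall>\<^sub>F n in sequentially.
        measure M {\<omega> \<in> space M. ennreal K < R n \<omega>} \<le> \<delta>)"

definition big_O_p :: "'w measure \<Rightarrow> (nat \<Rightarrow> 'w \<Rightarrow> ennreal) \<Rightarrow> (nat \<Rightarrow> real) \<Rightarrow> bool" where
  "big_O_p M V W \<longleftrightarrow>
     (\<exists>R. bounded_in_probability M R \<and>
          (\<forall>n\<ge>1. \<forall>\<omega>\<in>space M. V n \<omega> = R n \<omega> * ennreal (W n)))"

text \<open>\<open>f x = E[Y | X = x]\<close>. The library's conditional expectation is real-valued, hence the
  reduction to coordinates.\<close>

definition regression_function ::
  "'w measure \<Rightarrow> ('w \<Rightarrow> 'x::euclidean_space) \<Rightarrow> ('w \<Rightarrow> 'y::euclidean_space) \<Rightarrow> ('x \<Rightarrow> 'y) \<Rightarrow> bool" where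
  "regression_function M X Y f \<longleftrightarrow>
     f \<in> borel_measurable borel \<and> integrable M Y \<and>
     (\<forall>b\<in>Basis. AE \<omega> in M.
        real_cond_exp M (vimage_algebra (space M) X borel) (\<lambda>\<omega>. Y \<omega> \<bullet> b) \<omega> = f (X \<omega>) \<bullet> b)"

definition expected_cost ::
  "'w measure \<Rightarrow> ('w \<Rightarrow> 'y::euclidean_space) \<Rightarrow> ('x \<Rightarrow> 'y) \<Rightarrow> ('z \<Rightarrow> 'y \<Rightarrow> real) \<Rightarrow> 'z \<Rightarrow> 'x \<Rightarrow> real" where
  "expected_cost M \<epsilon> f c z x = (\<integral>\<omega>. c z (f x + \<epsilon> \<omega>) \<partial>M)"

text \<open>A realization of the data is a map \<open>D\<close> with \<open>D i = (y_i, x_i)\<close> for \<open>i = 1, ..., n\<close>;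
  \<open>residual h D i\<close> is the \<open>i\<close>-th error for \<open>h = f\<^sup>*\<close> and the \<open>i\<close>-th regression
  residual when \<open>h\<close> is the estimate.\<close>

definition residual :: "('x \<Rightarrow> 'y::ab_group_add) \<Rightarrow> (nat \<Rightarrow> 'y \<times> 'x) \<Rightarrow> nat \<Rightarrow> 'y" where
  "residual h D i = fst (D i) - h (snd (D i))"

definition full_info_cost ::
  "nat \<Rightarrow> ('x \<Rightarrow> 'y::euclidean_space) \<Rightarrow> (nat \<Rightarrow> 'y \<times> 'x) \<Rightarrow> ('z \<Rightarrow> 'y \<Rightarrow> real) \<Rightarrow> 'z \<Rightarrow> 'x \<Rightarrow> real" where
  "full_info_cost n f D c z x = (1 / real n) * (\<Sum>i=1..n. c z (f x + residual f D i))"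

text \<open>\<open>R\<^sup>n\<close> is represented by \<open>{1..n} \<rightarrow>\<^sub>E UNIV\<close>.\<close>

definition prob_vectors :: "nat \<Rightarrow> (nat \<Rightarrow> real) set" where
  "prob_vectors n = {p \<in> {1..n} \<rightarrow>\<^sub>E UNIV. (\<forall>i\<in>{1..n}. 0 \<le> p i) \<and> (\<Sum>i=1..n. p i) = 1}"

text \<open>The measure \<open>\<Sum>i=1..n. p i * \<delta>(ybar i)\<close>.\<close>

definition weighted_diracs :: "nat \<Rightarrow> (nat \<Rightarrow> real) \<Rightarrow> (nat \<Rightarrow> 'y::topological_space) \<Rightarrow> 'y measure" where
  "weighted_diracs n p ybar = distr (point_measure {1..n} (\<lambda>i. ennreal (p i))) borel ybar"

lemma emeasure_weighted_diracs:
  assumes "A \<in> sets borel"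
  shows "emeasure (weighted_diracs n p ybar) A =
    (\<Sum>i=1..n. ennreal (p i) * emeasure (return borel (ybar i)) A)"
proof -
  have "emeasure (weighted_diracs n p ybar) A =
      emeasure (point_measure {1..n} (\<lambda>i. ennreal (p i))) (ybar -` A \<inter> {1..n})"
    unfolding weighted_diracs_def using assms
    by (subst emeasure_distr) (auto simp: measurable_point_measure_eq1 space_point_measure)
  also have "\<dots> = (\<Sum>i\<in>ybar -` A \<inter> {1..n}. ennreal (p i))"
    by (rule emeasure_point_measure_finite) auto
  also have "\<dots> = (\<Sum>i=1..n. ennreal (p i) * indicator A (ybar i))"
    by (rule sum.mono_neutral_cong_left) (auto simp: indicator_def)
  finally show ?thesis
    using assms by simp
qed

definition residual_ball ::
  "'y::euclidean_space set \<Rightarrow> ('x \<Rightarrow> 'y) \<Rightarrow> (nat \<Rightarrow> 'y \<times> 'x) \<Rightarrow> 'x \<Rightarrow> real \<Rightarrow> nat \<Rightarrow> 'y set" where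
  "residual_ball \<Y> fhat D x \<mu> i =
     {y \<in> \<Y>. norm (y - closest_point \<Y> (fhat x + residual fhat D i)) \<le> \<mu>}"

definition ambiguity_set ::
  "nat \<Rightarrow> 'y::euclidean_space set \<Rightarrow> ('x \<Rightarrow> 'y) \<Rightarrow> (nat \<Rightarrow> 'y \<times> 'x) \<Rightarrow> (nat \<Rightarrow> real) set \<Rightarrow> real \<Rightarrow> 'x
    \<Rightarrow> 'y measure set" where
  "ambiguity_set n \<Y> fhat D \<PP> \<mu> x =
     {weighted_diracs n p ybar | p ybar.
        p \<in> \<PP> \<and> (\<forall>i\<in>{1..n}. ybar i \<in> residual_ball \<Y> fhat D x \<mu> i)}"

definition worst_case_cost :: "'y measure set \<Rightarrow> ('z \<Rightarrow> 'y \<Rightarrow> real) \<Rightarrow> 'z \<Rightarrow> ereal" where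
  "worst_case_cost \<Q> c z = (SUP Q\<in>\<Q>. ereal (\<integral>y. c z y \<partial>Q))"

end

theory Submission
  imports Defs
begin

text \<open>On the almost sure event that all points \<open>f x + \<epsilon>\<^sub>i\<close> lie in the closed convex set \<open>\<Y>\<close>, the
  projection onto \<open>\<Y>\<close> fixes them and is nonexpansive, so every atom of a distribution in the ambiguity
  set is within \<open>\<mu> x + norm (f x - fhat x) + norm (f x\<^sub>i - fhat x\<^sub>i)\<close> of \<open>f x + \<epsilon>\<^sub>i\<close>. The Lipschitz
  bound on the cost and two applications of Cauchy--Schwarz to the weights \<open>p\<^sub>i - 1/n\<close> then compare the
  worst-case objective with the full-information sample average, uniformly in \<open>z\<close>, and hypothesis (iii)
  compares the latter with \<open>g\<close>. A uniform gap \<open>T x\<close> between two objectives moves the minimum by at most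
  \<open>T x\<close>, and a minimizer of one is \<open>2 * T x\<close>-optimal for the other. Since only orders of magnitude matter,
  Minkowski's inequality for the \<open>L\<^sup>q\<close>-norm is replaced by a triangle inequality with factor \<open>4\<close>.\<close>

section \<open>Topological support of a measure\<close>

lemma closed_topological_support: "closed (topological_support N)"
proof -
  have "- topological_support N = \<Union>{U. open U \<and> emeasure N U = 0}"
    by (auto simp: topological_support_def not_gr_zero)
  then have "open (- topological_support N)"
    by (auto intro!: open_Union)
  then show ?thesis by (simp add: closed_def)
qed

text \<open>The complement of the support is a union of open null sets, possibly uncountably many.
  Second countability enters through Lindelof: a countable subfamily has the same union, which is
  therefore null.\<close>

lemma AE_topological_support:
  fixes N :: "'a::second_countable_topology measure"
  assumes "sets N = sets borel"
  shows "AE x in N. x \<in> topological_support N"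
proof -
  obtain \<F> where \<F>: "\<F> \<subseteq> {U. open U \<and> emeasure N U = 0}" "countable \<F>"
      "\<Union>\<F> = \<Union>{U. open U \<and> emeasure N U = 0}"
    using Lindelof[of "{U. open U \<and> emeasure N U = 0}"] by blast
  have "\<Union>\<F> \<in> null_sets N"
    using \<F> assms by (intro null_sets_UN'[of \<F> "\<lambda>U. U", simplified]) (auto simp: null_sets_def)
  moreover have "{x \<in> space N. x \<notin> topological_support N} \<subseteq> \<Union>\<F>"
    unfolding \<F>(3) by (auto simp: topological_support_def not_gr_zero)
  ultimately show ?thesis by (rule AE_I')
qed

section \<open>Powers and L^q-norms with values in [0,\<infinity>]\<close>

lemma ennreal_powr_mono: "s \<le> t \<Longrightarrow> 0 \<le> a \<Longrightarrow> ennreal_powr s a \<le> ennreal_powr t a"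
  by (auto simp: ennreal_powr_def top_unique less_top intro!: ennreal_leI powr_mono2 enn2real_mono)

lemma ennreal_powr_mult:
  assumes "0 < a" shows "ennreal_powr (s * t) a = ennreal_powr s a * ennreal_powr t a"
proof -
  \<comment> \<open>Settles the products with one infinite factor, where \<infinity> times zero is
    zero: the power of a positive real stays positive, so both sides are infinite together.\<close>
  have "ennreal (x powr a) > 0" if "x > 0" for x using that by auto
  then show ?thesis using assms
    by (cases s; cases t) (auto simp: ennreal_powr_def ennreal_mult[symmetric] powr_mult
      ennreal_top_mult ennreal_mult_top ennreal_mult_eq_top_iff enn2real_eq_0_iff)
qed

lemma ennreal_powr_inverse:
  assumes "0 < a" shows "ennreal_powr (ennreal_powr t a) (1 / a) = t"
  using assms by (cases t) (auto simp: ennreal_powr_def powr_powr)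

text \<open>The sum is at most twice the maximum. The constant is cruder than what convexity would
  give, but the bound holds for every positive exponent, and the triangle inequality below uses it
  for both \<open>a\<close> and \<open>1 / a\<close>.\<close>

lemma ennreal_powr_add_le:
  assumes "0 < a"
  shows "ennreal_powr (s + t) a \<le> ennreal_powr 2 a * (ennreal_powr s a + ennreal_powr t a)"
proof -
  have "s + t \<le> 2 * max s t"
    by (simp add: mult_2 add_mono)
  then have "ennreal_powr (s + t) a \<le> ennreal_powr 2 a * ennreal_powr (max s t) a"
    using assms by (simp add: ennreal_powr_mono flip: ennreal_powr_mult)
  also have "ennreal_powr (max s t) a \<le> ennreal_powr s a + ennreal_powr t a"
    by (simp add: max_def)
  finally show ?thesis by (simp add: mult_left_mono)
qed

lemma ennreal_powr_measurable [measurable]: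
  assumes [measurable]: "h \<in> borel_measurable N"
  shows "(\<lambda>x. ennreal_powr (h x) a) \<in> borel_measurable N"
  unfolding ennreal_powr_def by measurable

lemma enn2real_ge_1: "1 \<le> q \<Longrightarrow> q \<noteq> \<infinity> \<Longrightarrow> 1 \<le> enn2real q"
  by (cases q) auto

lemma Lq_norm_mono_AE:
  assumes "u \<in> borel_measurable N" "AE x in N. u x \<le> v x"
  shows "Lq_norm q N u \<le> Lq_norm q N v"
  using assms unfolding Lq_norm_def
  by (auto intro!: esssup_AE_mono ennreal_powr_mono nn_integral_mono_AE elim!: eventually_mono)

text \<open>The factor \<open>4\<close> is a product of two twos for finite \<open>q\<close>: the
  first is the outer root of the constant \<open>2 powr a\<close> taken out of the integral, the
  second bounds the constant \<open>2 powr (1 / a)\<close> that arises when the outer root of a sum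
  is split.\<close>

lemma Lq_norm_add_le:
  assumes q: "1 \<le> q" and [measurable]: "u \<in> borel_measurable N" "v \<in> borel_measurable N"
  shows "Lq_norm q N (\<lambda>x. u x + v x) \<le> 4 * (Lq_norm q N u + Lq_norm q N v)"
proof (cases "q = \<infinity>")
  case True
  have "esssup N (\<lambda>x. u x + v x) \<le> esssup N u + esssup N v"
    using esssup_AE[of u N] esssup_AE[of v N]
    by (intro esssup_I) (auto elim!: eventually_elim2 intro: add_mono)
  also have "\<dots> \<le> 4 * (esssup N u + esssup N v)"
    using mult_right_mono[of 1 4 "esssup N u + esssup N v"] by simp
  finally show ?thesis using True by (simp add: Lq_norm_def)
next
  case False
  define a where "a = enn2real q"
  have a: "1 \<le> a" unfolding a_def using q False by (rule enn2real_ge_1)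
  define I where "I w = (\<integral>\<^sup>+ x. ennreal_powr (w x) a \<partial>N)" for w
  have "I (\<lambda>x. u x + v x) \<le> (\<integral>\<^sup>+ x. ennreal_powr 2 a * (ennreal_powr (u x) a + ennreal_powr (v x) a) \<partial>N)"
    unfolding I_def using a by (intro nn_integral_mono ennreal_powr_add_le) auto
  also have "\<dots> = ennreal_powr 2 a * (I u + I v)"
    unfolding I_def by (subst nn_integral_cmult) (auto simp: nn_integral_add)
  finally have "ennreal_powr (I (\<lambda>x. u x + v x)) (1 / a) \<le> ennreal_powr (ennreal_powr 2 a * (I u + I v)) (1 / a)"
    using a by (intro ennreal_powr_mono) auto
  also have "\<dots> = 2 * ennreal_powr (I u + I v) (1 / a)"
    using a by (simp add: ennreal_powr_mult ennreal_powr_inverse)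
  also have "\<dots> \<le> 2 * (ennreal_powr 2 (1 / a) * (ennreal_powr (I u) (1 / a) + ennreal_powr (I v) (1 / a)))"
    using a by (intro mult_left_mono ennreal_powr_add_le) auto
  also have "\<dots> \<le> 2 * (2 * (ennreal_powr (I u) (1 / a) + ennreal_powr (I v) (1 / a)))"
  proof (intro mult_left_mono mult_right_mono)
    have "(2::real) powr (1 / a) \<le> 2 powr 1" using a by (intro powr_mono) auto
    then show "ennreal_powr 2 (1 / a) \<le> 2"
      using ennreal_leI[of "2 powr (1 / a)" 2] by (simp add: ennreal_powr_def)
  qed auto
  finally show ?thesis
    using False by (simp add: Lq_norm_def I_def a_def flip: mult.assoc)
qed

lemma Lq_norm_cmult_le:
  assumes q: "1 \<le> q" and [measurable]: "u \<in> borel_measurable N"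
  shows "Lq_norm q N (\<lambda>x. k * u x) \<le> k * Lq_norm q N u"
proof (cases "q = \<infinity>")
  case True
  have "esssup N (\<lambda>x. k * u x) \<le> k * esssup N u"
    using esssup_AE[of u N]
    by (intro esssup_I) (auto elim!: eventually_mono intro: mult_left_mono)
  then show ?thesis using True by (simp add: Lq_norm_def)
next
  case False
  then show ?thesis using enn2real_ge_1[OF q False]
    by (simp add: Lq_norm_def ennreal_powr_mult nn_integral_cmult ennreal_powr_inverse)
qed

lemma Lq_norm_const_le:
  assumes "prob_space N" and q: "1 \<le> q"
  shows "Lq_norm q N (\<lambda>x. k) \<le> k"
proof -
  interpret prob_space N by fact
  show ?thesis
  proof (cases "q = \<infinity>")
    case True
    then show ?thesis by (auto simp: Lq_norm_def)
  next
    case False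
    then show ?thesis using enn2real_ge_1[OF q False]
      by (simp add: Lq_norm_def emeasure_space_1 ennreal_powr_inverse)
  qed
qed

text \<open>Supplies the measurability in the data that \<open>big_O_p\<close> demands of the final
  norms. For finite \<open>q\<close> it is measurability of a parametric integral. For
  \<open>q = \<infinity>\<close> the essential supremum is at most \<open>y\<close> exactly where
  the integral of the indicator of exceeding \<open>y\<close> vanishes, which reduces to the same
  fact.\<close>

lemma measurable_Lq_norm:
  assumes N: "sigma_finite_measure N" and h: "(\<lambda>(\<omega>, x). h \<omega> x) \<in> borel_measurable (M \<Otimes>\<^sub>M N)"
  shows "(\<lambda>\<omega>. Lq_norm q N (h \<omega>)) \<in> borel_measurable M"
proof -
  interpret sigma_finite_measure N by fact
  note [measurable] = h
  have hx: "h \<omega> \<in> borel_measurable N" if "\<omega> \<in> space M" for \<omega>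
    using measurable_Pair2[OF h that] by simp
  show ?thesis
  proof (cases "q = \<infinity>")
    case True
    have "(\<lambda>\<omega>. esssup N (h \<omega>)) \<in> borel_measurable M"
    proof (rule borel_measurableI_le)
      fix y
      have "esssup N (h \<omega>) \<le> y \<longleftrightarrow> (AE x in N. h \<omega> x \<le> y)" if "\<omega> \<in> space M" for \<omega>
        using esssup_AE[of "h \<omega>" N] hx[OF that] by (auto elim: eventually_mono order_trans)
      then have "{\<omega> \<in> space M. esssup N (h \<omega>) \<le> y} = {\<omega> \<in> space M. AE x in N. h \<omega> x \<le> y}"
        by auto
      also have "\<dots> = {\<omega> \<in> space M. (\<integral>\<^sup>+ x. indicator {y<..} (h \<omega> x) \<partial>N) = 0}"
        using hx by (intro Collect_cong conj_cong refl)
          (subst nn_integral_0_iff_AE, auto simp: indicator_def not_less elim!: eventually_mono)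
      also have "\<dots> \<in> sets M" by measurable
      finally show "{\<omega> \<in> space M. esssup N (h \<omega>) \<le> y} \<in> sets M" .
    qed
    then show ?thesis using True by (simp add: Lq_norm_def)
  next
    case False
    then show ?thesis unfolding Lq_norm_def by simp
  qed
qed

section \<open>Calculus of tail bounds in probability\<close>

text \<open>Stochastic boundedness without the measurability demanded by \<^const>\<open>big_O_p\<close>, hence stable
  under almost sure domination.\<close>

definition tail_bounded :: "'w measure \<Rightarrow> (nat \<Rightarrow> 'w \<Rightarrow> ennreal) \<Rightarrow> (nat \<Rightarrow> real) \<Rightarrow> bool" where
  "tail_bounded M V W \<longleftrightarrow>
     (\<forall>\<delta>>0. \<exists>K\<ge>0. \<forall>\<^sub>F n in sequentially.
        \<exists>A\<in>sets M. measure M A \<le> \<delta> \<and> (\<forall>\<omega>\<in>space M - A. V n \<omega> \<le> ennreal (K * W n)))"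

lemma big_O_p_imp_tail_bounded:
  assumes "big_O_p M V W"
  shows "tail_bounded M V W"
  unfolding tail_bounded_def
proof (intro allI impI)
  fix \<delta> :: real assume "0 < \<delta>"
  obtain R where R: "bounded_in_probability M R" "\<forall>n\<ge>1. \<forall>\<omega>\<in>space M. V n \<omega> = R n \<omega> * ennreal (W n)"
    using assms unfolding big_O_p_def by blast
  have [measurable]: "R n \<in> borel_measurable M" for n
    using R(1) unfolding bounded_in_probability_def by blast
  obtain K where "\<forall>\<^sub>F n in sequentially. measure M {\<omega> \<in> space M. ennreal K < R n \<omega>} \<le> \<delta>"
    using R(1) \<open>0 < \<delta>\<close> unfolding bounded_in_probability_def by blast
  \<comment> \<open>A negative \<open>K\<close> acts as zero under \<open>ennreal\<close>, so
    \<open>max K 0\<close> yields the same bound and is a nonnegative constant. The exceptional set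
    is the tail event itself.\<close>
  then have "\<forall>\<^sub>F n in sequentially. \<exists>A\<in>sets M. measure M A \<le> \<delta> \<and>
      (\<forall>\<omega>\<in>space M - A. V n \<omega> \<le> ennreal (max K 0 * W n))"
    using eventually_ge_at_top[of 1]
  proof eventually_elim
    case (elim n)
    show ?case
    proof (intro bexI[of _ "{\<omega> \<in> space M. ennreal K < R n \<omega>}"] conjI ballI)
      fix \<omega> assume "\<omega> \<in> space M - {\<omega> \<in> space M. ennreal K < R n \<omega>}"
      then have "\<omega> \<in> space M" "R n \<omega> \<le> ennreal (max K 0)"
        by (auto simp: max_def ennreal_neg not_less split: if_splits)
      then show "V n \<omega> \<le> ennreal (max K 0 * W n)"
        using R(2) elim(2) by (auto simp: ennreal_mult' intro: mult_right_mono)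
    qed (use elim in auto)
  qed
  then show "\<exists>K\<ge>0. \<forall>\<^sub>F n in sequentially. \<exists>A\<in>sets M. measure M A \<le> \<delta> \<and>
      (\<forall>\<omega>\<in>space M - A. V n \<omega> \<le> ennreal (K * W n))"
    by (intro exI[of _ "max K 0"]) auto
qed

lemma tail_bounded_imp_big_O_p:
  assumes "finite_measure M" and V: "\<And>n. 1 \<le> n \<Longrightarrow> V n \<in> borel_measurable M"
    and W: "\<And>n. 1 \<le> n \<Longrightarrow> 0 < W n" and tail: "tail_bounded M V W"
  shows "big_O_p M V W"
proof -
  interpret finite_measure M by fact
  \<comment> \<open>The quotient of \<open>V n\<close> by the rate. Index \<open>0\<close> gets the
    value \<open>0\<close> because \<open>R\<close> must be measurable at every index, whereas
    \<open>V\<close> and \<open>W\<close> are controlled only from \<open>1\<close> on.\<close>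
  define R where "R n \<omega> = (if 1 \<le> n then V n \<omega> * ennreal (1 / W n) else 0)" for n \<omega>
  have [measurable]: "R n \<in> borel_measurable M" for n
    using V[of n] unfolding R_def by (cases "1 \<le> n") auto
  have cancel: "t * ennreal (1 / W n) * ennreal (W n) = t" "t * ennreal (W n) * ennreal (1 / W n) = t"
    if "1 \<le> n" for n t
    using W[OF that] by (simp_all add: mult.assoc ennreal_mult[symmetric])
  have "bounded_in_probability M R"
    unfolding bounded_in_probability_def
  proof (intro conjI allI impI)
    fix \<delta> :: real assume "0 < \<delta>"
    then obtain K where K: "K \<ge> 0" "\<forall>\<^sub>F n in sequentially. \<exists>A\<in>sets M. measure M A \<le> \<delta> \<and>
        (\<forall>\<omega>\<in>space M - A. V n \<omega> \<le> ennreal (K * W n))"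
      using tail unfolding tail_bounded_def by blast
    have "\<forall>\<^sub>F n in sequentially. measure M {\<omega> \<in> space M. ennreal K < R n \<omega>} \<le> \<delta>"
      using K(2) eventually_ge_at_top[of 1]
    proof eventually_elim
      case (elim n)
      then obtain A where A: "A \<in> sets M" "measure M A \<le> \<delta>"
          "\<And>\<omega>. \<omega> \<in> space M - A \<Longrightarrow> V n \<omega> \<le> ennreal (K * W n)"
        by blast
      \<comment> \<open>Off \<open>A\<close> the bound on \<open>V n\<close> divides by
        \<open>W n\<close> to give \<open>R n \<omega> \<le> ennreal K\<close>, so the tail event
        cannot leave the exceptional set.\<close>
      have "{\<omega> \<in> space M. ennreal K < R n \<omega>} \<subseteq> A"
      proof (rule subsetI, rule ccontr)
        fix \<omega> assume \<omega>: "\<omega> \<in> {\<omega> \<in> space M. ennreal K < R n \<omega>}" "\<omega> \<notin> A"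
        then have "V n \<omega> * ennreal (1 / W n) \<le> ennreal K * ennreal (W n) * ennreal (1 / W n)"
          using A(3) K(1) by (intro mult_right_mono) (auto simp: ennreal_mult')
        with \<omega> elim(2) show False by (auto simp: R_def cancel)
      qed
      then have "measure M {\<omega> \<in> space M. ennreal K < R n \<omega>} \<le> measure M A"
        using A(1) by (intro finite_measure_mono)
      with A(2) show ?case by simp
    qed
    then show "\<exists>K. \<forall>\<^sub>F n in sequentially. measure M {\<omega> \<in> space M. ennreal K < R n \<omega>} \<le> \<delta>" ..
  qed simp
  moreover have "\<forall>n\<ge>1. \<forall>\<omega>\<in>space M. V n \<omega> = R n \<omega> * ennreal (W n)"
    by (auto simp: R_def cancel)
  ultimately show ?thesis unfolding big_O_p_def by blast
qed

lemma big_O_imp_tail_bounded: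
  assumes "big_O V W" "\<And>n. 1 \<le> n \<Longrightarrow> 0 \<le> W n"
  shows "tail_bounded M (\<lambda>n _. V n) W"
proof -
  obtain C where C: "\<forall>\<^sub>F n in sequentially. V n \<le> ennreal (C * W n)"
    using assms(1) unfolding big_O_def by blast
  have "\<forall>\<^sub>F n in sequentially. V n \<le> ennreal (max C 0 * W n)"
    using C eventually_ge_at_top[of 1]
  proof eventually_elim
    case (elim n)
    have "C * W n \<le> max C 0 * W n"
      using assms(2)[OF elim(2)] by (intro mult_right_mono) auto
    then show ?case using elim(1) order_trans ennreal_leI by blast
  qed
  then show ?thesis
    unfolding tail_bounded_def
    by (intro allI impI exI[of _ "max C 0"] conjI) (auto elim!: eventually_mono intro: bexI[of _ "{}"])
qed

lemma tail_bounded_add: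
  assumes "finite_measure M" "\<And>n. 1 \<le> n \<Longrightarrow> 0 \<le> W n" "tail_bounded M U W" "tail_bounded M V W"
  shows "tail_bounded M (\<lambda>n \<omega>. U n \<omega> + V n \<omega>) W"
  unfolding tail_bounded_def
proof (intro allI impI)
  interpret finite_measure M by fact
  fix \<delta> :: real assume "0 < \<delta>"
  then have d: "0 < \<delta> / 2" by simp
  obtain J where J: "J \<ge> 0" "\<forall>\<^sub>F n in sequentially. \<exists>A\<in>sets M. measure M A \<le> \<delta> / 2 \<and>
      (\<forall>\<omega>\<in>space M - A. U n \<omega> \<le> ennreal (J * W n))"
    using assms(3) d unfolding tail_bounded_def by blast
  obtain K where K: "K \<ge> 0" "\<forall>\<^sub>F n in sequentially. \<exists>A\<in>sets M. measure M A \<le> \<delta> / 2 \<and>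
      (\<forall>\<omega>\<in>space M - A. V n \<omega> \<le> ennreal (K * W n))"
    using assms(4) d unfolding tail_bounded_def by blast
  have "\<forall>\<^sub>F n in sequentially. \<exists>A\<in>sets M. measure M A \<le> \<delta> \<and>
      (\<forall>\<omega>\<in>space M - A. U n \<omega> + V n \<omega> \<le> ennreal ((J + K) * W n))"
    using J(2) K(2) eventually_ge_at_top[of 1]
  proof eventually_elim
    case (elim n)
    obtain A where A: "A \<in> sets M" "measure M A \<le> \<delta> / 2"
        "\<And>\<omega>. \<omega> \<in> space M - A \<Longrightarrow> U n \<omega> \<le> ennreal (J * W n)"
      using elim(1) by blast
    obtain B where B: "B \<in> sets M" "measure M B \<le> \<delta> / 2"
        "\<And>\<omega>. \<omega> \<in> space M - B \<Longrightarrow> V n \<omega> \<le> ennreal (K * W n)"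
      using elim(2) by blast
    show ?case
    proof (intro bexI[of _ "A \<union> B"] conjI ballI)
      show "measure M (A \<union> B) \<le> \<delta>"
        using measure_Un_le[OF A(1) B(1)] A(2) B(2) by simp
      show "U n \<omega> + V n \<omega> \<le> ennreal ((J + K) * W n)" if "\<omega> \<in> space M - (A \<union> B)" for \<omega>
        using add_mono[OF A(3) B(3), of \<omega> \<omega>] that assms(2)[OF elim(3)] J(1) K(1)
        by (simp add: ennreal_plus[symmetric] algebra_simps del: ennreal_plus)
    qed (use A B in auto)
  qed
  then show "\<exists>K\<ge>0. \<forall>\<^sub>F n in sequentially. \<exists>A\<in>sets M. measure M A \<le> \<delta> \<and>
      (\<forall>\<omega>\<in>space M - A. U n \<omega> + V n \<omega> \<le> ennreal (K * W n))"
    using J(1) K(1) by (intro exI[of _ "J + K"]) auto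
qed

lemma tail_bounded_dominated:
  assumes "finite_measure M" "tail_bounded M V W" "0 \<le> k"
    and le: "\<forall>\<^sub>F n in sequentially. AE \<omega> in M. U n \<omega> \<le> ennreal k * V n \<omega>"
  shows "tail_bounded M U W"
  unfolding tail_bounded_def
proof (intro allI impI)
  interpret finite_measure M by fact
  fix \<delta> :: real assume "0 < \<delta>"
  then obtain K where K: "K \<ge> 0" "\<forall>\<^sub>F n in sequentially. \<exists>A\<in>sets M. measure M A \<le> \<delta> \<and>
      (\<forall>\<omega>\<in>space M - A. V n \<omega> \<le> ennreal (K * W n))"
    using assms(2) unfolding tail_bounded_def by blast
  have "\<forall>\<^sub>F n in sequentially. \<exists>A\<in>sets M. measure M A \<le> \<delta> \<and>
      (\<forall>\<omega>\<in>space M - A. U n \<omega> \<le> ennreal (k * K * W n))"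
    using K(2) le
  proof eventually_elim
    case (elim n)
    obtain A where A: "A \<in> sets M" "measure M A \<le> \<delta>"
        "\<And>\<omega>. \<omega> \<in> space M - A \<Longrightarrow> V n \<omega> \<le> ennreal (K * W n)"
      using elim(1) by blast
    \<comment> \<open>The null set on which domination fails is added to the exceptional set without
      changing its measure.\<close>
    obtain B where B: "B \<in> null_sets M" "\<And>\<omega>. \<omega> \<in> space M - B \<Longrightarrow> U n \<omega> \<le> ennreal k * V n \<omega>"
      using elim(2) by (auto elim!: AE_E2 simp: eventually_ae_filter)
    show ?case
    proof (intro bexI[of _ "A \<union> B"] conjI ballI)
      show "measure M (A \<union> B) \<le> \<delta>"
        using A B by (simp add: measure_Un_null_set)
      fix \<omega> assume \<omega>: "\<omega> \<in> space M - (A \<union> B)"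
      then have "U n \<omega> \<le> ennreal k * V n \<omega>" using B(2) by blast
      also have "\<dots> \<le> ennreal k * ennreal (K * W n)" using A(3) \<omega> by (intro mult_left_mono) auto
      finally show "U n \<omega> \<le> ennreal (k * K * W n)"
        using \<open>0 \<le> k\<close> by (simp add: ennreal_mult' mult.assoc)
    qed (use A B in auto)
  qed
  then show "\<exists>K\<ge>0. \<forall>\<^sub>F n in sequentially. \<exists>A\<in>sets M. measure M A \<le> \<delta> \<and>
      (\<forall>\<omega>\<in>space M - A. U n \<omega> \<le> ennreal (K * W n))"
    using K(1) \<open>0 \<le> k\<close> by (intro exI[of _ "k * K"]) auto
qed

lemma tail_bounded_rate_mono:
  assumes "tail_bounded M V W" "\<And>n. 1 \<le> n \<Longrightarrow> W n \<le> W' n"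
  shows "tail_bounded M V W'"
  unfolding tail_bounded_def
proof (intro allI impI)
  fix \<delta> :: real assume "0 < \<delta>"
  then obtain K where K: "K \<ge> 0" "\<forall>\<^sub>F n in sequentially. \<exists>A\<in>sets M. measure M A \<le> \<delta> \<and>
      (\<forall>\<omega>\<in>space M - A. V n \<omega> \<le> ennreal (K * W n))"
    using assms(1) unfolding tail_bounded_def by blast
  have "\<forall>\<^sub>F n in sequentially. \<exists>A\<in>sets M. measure M A \<le> \<delta> \<and>
      (\<forall>\<omega>\<in>space M - A. V n \<omega> \<le> ennreal (K * W' n))"
    using K(2) eventually_ge_at_top[of 1]
  proof eventually_elim
    case (elim n)
    have "ennreal (K * W n) \<le> ennreal (K * W' n)"
      using K(1) assms(2)[OF elim(2)] by (intro ennreal_leI mult_left_mono)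
    then show ?case using elim(1) order_trans by blast
  qed
  then show "\<exists>K\<ge>0. \<forall>\<^sub>F n in sequentially. \<exists>A\<in>sets M. measure M A \<le> \<delta> \<and>
      (\<forall>\<omega>\<in>space M - A. V n \<omega> \<le> ennreal (K * W' n))"
    using K(1) by blast
qed

text \<open>Meant for a factor that is only stochastically bounded and multiplied by a deterministic
  rate: the product then has that rate.\<close>

lemma tail_bounded_scale:
  assumes "tail_bounded M V W" "\<And>n. 0 \<le> w n"
  shows "tail_bounded M (\<lambda>n \<omega>. ennreal (w n) * V n \<omega>) (\<lambda>n. w n * W n)"
  unfolding tail_bounded_def
proof (intro allI impI)
  fix \<delta> :: real assume "0 < \<delta>"
  then obtain K where K: "K \<ge> 0" "\<forall>\<^sub>F n in sequentially. \<exists>A\<in>sets M. measure M A \<le> \<delta> \<and>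
      (\<forall>\<omega>\<in>space M - A. V n \<omega> \<le> ennreal (K * W n))"
    using assms(1) unfolding tail_bounded_def by blast
  have scale: "ennreal (w n) * t \<le> ennreal (K * (w n * W n))" if "t \<le> ennreal (K * W n)" for n t
    using mult_left_mono[OF that, of "ennreal (w n)"] assms(2)[of n]
    by (simp add: ennreal_mult'[symmetric] mult.left_commute)
  have "\<forall>\<^sub>F n in sequentially. \<exists>A\<in>sets M. measure M A \<le> \<delta> \<and>
      (\<forall>\<omega>\<in>space M - A. ennreal (w n) * V n \<omega> \<le> ennreal (K * (w n * W n)))"
    using K(2) by (rule eventually_mono) (meson scale)
  then show "\<exists>K\<ge>0. \<forall>\<^sub>F n in sequentially. \<exists>A\<in>sets M. measure M A \<le> \<delta> \<and>
      (\<forall>\<omega>\<in>space M - A. ennreal (w n) * V n \<omega> \<le> ennreal (K * (w n * W n)))"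
    using K(1) by blast
qed

text \<open>Turns the order \<open>n powr (- r)\<close> of the mean squared prediction error into
  the order \<open>n powr (- r / 2)\<close> of its root.\<close>

lemma tail_bounded_sqrt:
  assumes "tail_bounded M (\<lambda>n \<omega>. ennreal (v n \<omega>)) W"
  shows "tail_bounded M (\<lambda>n \<omega>. ennreal (sqrt (v n \<omega>))) (\<lambda>n. sqrt (W n))"
  unfolding tail_bounded_def
proof (intro allI impI)
  fix \<delta> :: real assume "0 < \<delta>"
  then obtain K where K: "K \<ge> 0" "\<forall>\<^sub>F n in sequentially. \<exists>A\<in>sets M. measure M A \<le> \<delta> \<and>
      (\<forall>\<omega>\<in>space M - A. ennreal (v n \<omega>) \<le> ennreal (K * W n))"
    using assms unfolding tail_bounded_def by blast
  \<comment> \<open>\<open>sqrt\<close> is an odd function on the reals and \<open>ennreal\<close>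
    sends negative numbers to zero; the case split on signs keeps the two conventions
    consistent.\<close>
  have root: "ennreal (sqrt a) \<le> ennreal (sqrt K * sqrt b)" if "ennreal a \<le> ennreal (K * b)" for a b
    using that by (cases "0 \<le> K * b"; cases "0 \<le> a")
      (auto simp: ennreal_neg ennreal_le_iff real_sqrt_mult[symmetric] intro!: ennreal_leI)
  have "\<forall>\<^sub>F n in sequentially. \<exists>A\<in>sets M. measure M A \<le> \<delta> \<and>
      (\<forall>\<omega>\<in>space M - A. ennreal (sqrt (v n \<omega>)) \<le> ennreal (sqrt K * sqrt (W n)))"
    using K(2) by (rule eventually_mono) (meson root)
  then show "\<exists>K\<ge>0. \<forall>\<^sub>F n in sequentially. \<exists>A\<in>sets M. measure M A \<le> \<delta> \<and>
      (\<forall>\<omega>\<in>space M - A. ennreal (sqrt (v n \<omega>)) \<le> ennreal (K * sqrt (W n)))"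
    using K(1) by (intro exI[of _ "sqrt K"]) auto
qed

section \<open>Minimal values under uniform perturbation\<close>

lemma min_value_attained:
  assumes "z0 \<in> S" "\<And>z. z \<in> S \<Longrightarrow> F z0 \<le> F z"
  shows "min_value S F = real_of_ereal (F z0)"
proof -
  have "(INF z\<in>S. F z) = F z0"
    using assms by (intro antisym INF_lower INF_greatest)
  then show ?thesis by (simp add: min_value_def)
qed

text \<open>Only \<open>F\<close> needs a minimizer. With \<open>m\<close> its minimal value,
  closeness gives \<open>m - t\<close> as a lower bound of \<open>G\<close> on all of
  \<open>S\<close> and \<open>m + t\<close> as an upper bound of \<open>G z0\<close>. The infimum of
  \<open>G\<close> is thus within \<open>t\<close> of \<open>m\<close>, and \<open>G z0\<close>
  exceeds it by at most \<open>2 * t\<close>.\<close>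

lemma min_value_perturbation:
  fixes F :: "'a \<Rightarrow> ereal" and G :: "'a \<Rightarrow> real"
  assumes z0: "z0 \<in> S" "\<And>z. z \<in> S \<Longrightarrow> F z0 \<le> F z" "\<bar>F z0\<bar> \<noteq> \<infinity>"
    and close: "\<And>z. z \<in> S \<Longrightarrow> F z \<le> ereal (G z + t)" "\<And>z. z \<in> S \<Longrightarrow> ereal (G z - t) \<le> F z"
  shows "\<bar>min_value S F - min_value S (\<lambda>z. ereal (G z))\<bar> \<le> t"
    and "\<bar>G z0 - min_value S (\<lambda>z. ereal (G z))\<bar> \<le> 2 * t"
proof -
  obtain m where m: "F z0 = ereal m"
    using z0(3) by (cases "F z0") auto
  have minF: "min_value S F = m"
    using min_value_attained[of z0 S F] z0(1,2) m by simp
  have lower: "m - t \<le> G z" if "z \<in> S" for z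
  proof -
    have "ereal m \<le> ereal (G z + t)" using z0(2)[OF that] close(1)[OF that] m by (metis order_trans)
    then show ?thesis by simp
  qed
  have upper: "G z0 \<le> m + t"
    using close(2)[OF z0(1)] m by simp
  have "ereal (m - t) \<le> (INF z\<in>S. ereal (G z))"
    using lower by (intro INF_greatest) simp
  moreover have "(INF z\<in>S. ereal (G z)) \<le> ereal (G z0)"
    using z0(1) by (rule INF_lower)
  \<comment> \<open>The extended infimum is caught between two reals, hence finite, so the
    conversion to a real in \<open>min_value\<close> is faithful.\<close>
  ultimately have "m - t \<le> min_value S (\<lambda>z. ereal (G z))" "min_value S (\<lambda>z. ereal (G z)) \<le> G z0"
    unfolding min_value_def by (cases "INF z\<in>S. ereal (G z)"; auto)+
  then show "\<bar>min_value S F - min_value S (\<lambda>z. ereal (G z))\<bar> \<le> t"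
    and "\<bar>G z0 - min_value S (\<lambda>z. ereal (G z))\<bar> \<le> 2 * t"
    using minF upper by auto
qed

section \<open>Cost under a discrete distribution against the sample average\<close>

lemma integral_weighted_diracs:
  fixes h :: "'y::euclidean_space \<Rightarrow> real"
  assumes [measurable]: "h \<in> borel_measurable borel" and "\<And>i. i \<in> {1..n} \<Longrightarrow> 0 \<le> p i"
  shows "(\<integral>y. h y \<partial>weighted_diracs n p ybar) = (\<Sum>i=1..n. p i * h (ybar i))"
proof -
  have "(\<integral>y. h y \<partial>weighted_diracs n p ybar) = (\<integral>i. h (ybar i) \<partial>point_measure {1..n} (\<lambda>i. ennreal (p i)))"
    unfolding weighted_diracs_def by (subst integral_distr) (auto simp: measurable_point_measure_eq1)
  also have "\<dots> = (\<Sum>i=1..n. p i *\<^sub>R h (ybar i))"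
    using assms(2) by (intro lebesgue_integral_point_measure_finite) auto
  finally show ?thesis by simp
qed

lemma abs_sum_mult_le_sqrt:
  fixes a b :: "'i \<Rightarrow> real"
  shows "\<bar>\<Sum>i\<in>I. a i * b i\<bar> \<le> sqrt (\<Sum>i\<in>I. (a i)\<^sup>2) * sqrt (\<Sum>i\<in>I. (b i)\<^sup>2)"
  unfolding real_sqrt_mult[symmetric]
  using real_sqrt_le_mono[OF Cauchy_Schwarz_ineq_sum[of a b I]] by simp

text \<open>Cauchy-Schwarz for the weights minus \<open>1 / real n\<close>. Writing their squared
  sum as at most \<open>s\<^sup>2 / real n\<close> lets the factor \<open>1 / real n\<close> pass to
  the second sum, which becomes a quadratic mean; \<open>s\<close> is then the only rate
  left.\<close>

lemma weight_perturbation_le: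
  fixes p w :: "nat \<Rightarrow> real"
  assumes "1 \<le> n" "0 \<le> s" "(\<Sum>i=1..n. (p i - 1 / real n)\<^sup>2) \<le> s\<^sup>2 / real n"
  shows "\<bar>(\<Sum>i=1..n. p i * w i) - (\<Sum>i=1..n. w i) / real n\<bar> \<le> s * sqrt (1 / real n * (\<Sum>i=1..n. (w i)\<^sup>2))"
proof -
  have "(\<Sum>i=1..n. p i * w i) - (\<Sum>i=1..n. w i) / real n = (\<Sum>i=1..n. (p i - 1 / real n) * w i)"
    by (simp add: left_diff_distrib sum_subtractf sum_divide_distrib)
  also have "\<bar>\<dots>\<bar> \<le> sqrt (\<Sum>i=1..n. (p i - 1 / real n)\<^sup>2) * sqrt (\<Sum>i=1..n. (w i)\<^sup>2)"
    by (rule abs_sum_mult_le_sqrt)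
  also have "\<dots> \<le> sqrt (s\<^sup>2 / real n) * sqrt (\<Sum>i=1..n. (w i)\<^sup>2)"
    using assms by (intro mult_right_mono) (auto simp: sum_nonneg)
  also have "\<dots> = s * sqrt (1 / real n * (\<Sum>i=1..n. (w i)\<^sup>2))"
    using assms by (simp add: real_sqrt_mult real_sqrt_divide)
  finally show ?thesis .
qed

lemma mean_le_quadratic_mean:
  fixes w :: "nat \<Rightarrow> real"
  assumes "1 \<le> n"
  shows "(\<Sum>i=1..n. w i) / real n \<le> sqrt (1 / real n * (\<Sum>i=1..n. (w i)\<^sup>2))"
proof -
  have "(\<Sum>i=1..n. w i) \<le> sqrt (real n) * sqrt (\<Sum>i=1..n. (w i)\<^sup>2)"
    using abs_sum_mult_le_sqrt[of "\<lambda>_. 1" w "{1..n}"] by simp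
  then have "(\<Sum>i=1..n. w i) / real n \<le> sqrt (real n) * sqrt (\<Sum>i=1..n. (w i)\<^sup>2) / real n"
    by (intro divide_right_mono) auto
  also have "\<dots> = sqrt (1 / real n * (\<Sum>i=1..n. (w i)\<^sup>2))"
    using assms by (simp add: real_sqrt_mult real_sqrt_divide field_simps)
  finally show ?thesis .
qed

lemma residual_ball_dist_le:
  fixes S :: "'y::euclidean_space set"
  assumes "convex S" "closed S" and S: "f x + residual f d i \<in> S"
    and y: "y \<in> residual_ball S fh d x \<mu> i"
  shows "norm (y - (f x + residual f d i)) \<le> \<mu> + norm (f x - fh x) + norm (f (snd (d i)) - fh (snd (d i)))"
proof -
  have "dist (closest_point S (fh x + residual fh d i)) (closest_point S (f x + residual f d i))
      \<le> dist (fh x + residual fh d i) (f x + residual f d i)"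
    using assms by (intro closest_point_lipschitz) auto
  moreover have "closest_point S (f x + residual f d i) = f x + residual f d i"
    using S by (rule closest_point_self)
  moreover have "dist (fh x + residual fh d i) (f x + residual f d i)
      \<le> norm (f x - fh x) + norm (f (snd (d i)) - fh (snd (d i)))"
  proof -
    \<comment> \<open>The observed response cancels between the two residuals, leaving only the
      prediction errors at \<open>x\<close> and at the sample covariate.\<close>
    have "(fh x + residual fh d i) - (f x + residual f d i) = (f (snd (d i)) - fh (snd (d i))) - (f x - fh x)"
      by (simp add: residual_def algebra_simps)
    then show ?thesis
      unfolding dist_norm by (metis add.commute norm_triangle_ineq4)
  qed
  moreover have "dist y (closest_point S (fh x + residual fh d i)) \<le> \<mu>"
    using y by (simp add: residual_ball_def dist_norm)
  ultimately show ?thesis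
    using dist_triangle[of y "f x + residual f d i" "closest_point S (fh x + residual fh d i)"]
    by (simp add: dist_norm)
qed

text \<open>The intermediate quantity is the average of \<open>c z (f x + residual f d i)\<close>
  with weights \<open>p\<close>. Moving the atoms there costs the Lipschitz terms; replacing the
  weights by uniform ones costs \<open>s\<close> times the quadratic mean of the costs.\<close>

lemma discrete_cost_gap:
  fixes S :: "'y::euclidean_space set"
  assumes n: "1 \<le> n" and S: "convex S" "closed S"
    and lip: "l-lipschitz_on S (c z)" and [measurable]: "c z \<in> borel_measurable borel"
    and p: "p \<in> prob_vectors n" and ybar: "\<And>i. i \<in> {1..n} \<Longrightarrow> ybar i \<in> residual_ball S fh d x \<mu> i"
    and true: "\<And>i. i \<in> {1..n} \<Longrightarrow> f x + residual f d i \<in> S"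
    and s: "0 \<le> s" "(\<Sum>i=1..n. (p i - 1 / real n)\<^sup>2) \<le> s\<^sup>2 / real n"
  shows "\<bar>(\<integral>y. c z y \<partial>weighted_diracs n p ybar) - full_info_cost n f d c z x\<bar> \<le>
    l * (\<mu> + norm (f x - fh x) +
      (1 + s) * sqrt (1 / real n * (\<Sum>i=1..n. (norm (f (snd (d i)) - fh (snd (d i))))\<^sup>2)))
    + s * sqrt (1 / real n * (\<Sum>i=1..n. (c z (f x + residual f d i))\<^sup>2))"
proof -
  have p0: "0 \<le> p i" if "i \<in> {1..n}" for i
    using p that by (auto simp: prob_vectors_def)
  have p1: "(\<Sum>i=1..n. p i) = 1"
    using p by (auto simp: prob_vectors_def)
  have l: "0 \<le> l" using lip by (rule lipschitz_on_nonneg)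
  define y where "y i = f x + residual f d i" for i
  define a where "a i = norm (f (snd (d i)) - fh (snd (d i)))" for i
  define m where "m = sqrt (1 / real n * (\<Sum>i=1..n. (a i)\<^sup>2))"
  have "\<bar>(\<Sum>i=1..n. p i * c z (ybar i)) - (\<Sum>i=1..n. p i * c z (y i))\<bar>
      = \<bar>\<Sum>i=1..n. p i * (c z (ybar i) - c z (y i))\<bar>"
    by (simp add: right_diff_distrib sum_subtractf)
  also have "\<dots> \<le> (\<Sum>i=1..n. \<bar>p i * (c z (ybar i) - c z (y i))\<bar>)"
    by (rule sum_abs)
  also have "\<dots> \<le> (\<Sum>i=1..n. p i * (l * (\<mu> + norm (f x - fh x) + a i)))"
  proof (rule sum_mono)
    fix i assume i: "i \<in> {1..n}"
    have "\<bar>c z (ybar i) - c z (y i)\<bar> \<le> l * norm (ybar i - y i)"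
      using lipschitz_onD[OF lip, of "ybar i" "y i"] ybar[OF i] true[OF i]
      by (auto simp: dist_norm residual_ball_def y_def)
    also have "\<dots> \<le> l * (\<mu> + norm (f x - fh x) + a i)"
      using residual_ball_dist_le[where f = f, OF S true[OF i] ybar[OF i]] l
      unfolding y_def a_def by (intro mult_left_mono) auto
    finally show "\<bar>p i * (c z (ybar i) - c z (y i))\<bar> \<le> p i * (l * (\<mu> + norm (f x - fh x) + a i))"
      using p0[OF i] by (simp add: abs_mult mult_left_mono)
  qed
  also have "\<dots> = l * ((\<Sum>i=1..n. p i) * (\<mu> + norm (f x - fh x)) + (\<Sum>i=1..n. p i * a i))"
    by (simp add: sum_distrib_left sum_distrib_right sum.distrib algebra_simps)
  \<comment> \<open>The errors \<open>a i\<close> are averaged with weights \<open>p\<close>: the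
    uniform mean is at most the quadratic mean \<open>m\<close>, and the change of weights adds at
    most \<open>s * m\<close>.\<close>
  also have "(\<Sum>i=1..n. p i * a i) \<le> (1 + s) * m"
    using weight_perturbation_le[OF n s, of a] mean_le_quadratic_mean[OF n, of a]
    unfolding m_def by (simp add: algebra_simps abs_le_iff)
  finally have shift: "\<bar>(\<Sum>i=1..n. p i * c z (ybar i)) - (\<Sum>i=1..n. p i * c z (y i))\<bar>
      \<le> l * (\<mu> + norm (f x - fh x) + (1 + s) * m)"
    using l p1 by (simp add: mult_left_mono)
  have "(\<integral>y. c z y \<partial>weighted_diracs n p ybar) = (\<Sum>i=1..n. p i * c z (ybar i))"
    using p0 by (intro integral_weighted_diracs) auto
  then show ?thesis
    using shift weight_perturbation_le[OF n s, of "\<lambda>i. c z (y i)"]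
    by (simp add: full_info_cost_def m_def a_def y_def)
qed

section \<open>Tail bounds for L^q-norms of random functions\<close>

lemma tail_bounded_Lq_add:
  assumes M: "finite_measure M" and q: "1 \<le> q" and W: "\<And>n. 1 \<le> n \<Longrightarrow> 0 \<le> W n"
    and U: "tail_bounded M (\<lambda>n \<omega>. Lq_norm q N (U n \<omega>)) W"
      "\<And>n \<omega>. 1 \<le> n \<Longrightarrow> \<omega> \<in> space M \<Longrightarrow> U n \<omega> \<in> borel_measurable N"
    and V: "tail_bounded M (\<lambda>n \<omega>. Lq_norm q N (V n \<omega>)) W"
      "\<And>n \<omega>. 1 \<le> n \<Longrightarrow> \<omega> \<in> space M \<Longrightarrow> V n \<omega> \<in> borel_measurable N"
  shows "tail_bounded M (\<lambda>n \<omega>. Lq_norm q N (\<lambda>x. U n \<omega> x + V n \<omega> x)) W"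
proof (rule tail_bounded_dominated[OF M tail_bounded_add[OF M W U(1) V(1)], of 4])
  show "\<forall>\<^sub>F n in sequentially. AE \<omega> in M. Lq_norm q N (\<lambda>x. U n \<omega> x + V n \<omega> x)
      \<le> ennreal 4 * (Lq_norm q N (U n \<omega>) + Lq_norm q N (V n \<omega>))"
    using eventually_ge_at_top[of 1]
  proof eventually_elim
    case (elim n)
    show ?case using Lq_norm_add_le[OF q U(2) V(2), OF elim _ elim] by (intro AE_I2) simp
  qed
qed auto

lemma tail_bounded_Lq_cmult:
  assumes M: "finite_measure M" and q: "1 \<le> q" and k: "0 \<le> k"
    and U: "tail_bounded M (\<lambda>n \<omega>. Lq_norm q N (U n \<omega>)) W"
      "\<And>n \<omega>. 1 \<le> n \<Longrightarrow> \<omega> \<in> space M \<Longrightarrow> U n \<omega> \<in> borel_measurable N"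
  shows "tail_bounded M (\<lambda>n \<omega>. Lq_norm q N (\<lambda>x. ennreal k * U n \<omega> x)) W"
proof (rule tail_bounded_dominated[OF M U(1) k])
  show "\<forall>\<^sub>F n in sequentially. AE \<omega> in M. Lq_norm q N (\<lambda>x. ennreal k * U n \<omega> x)
      \<le> ennreal k * Lq_norm q N (U n \<omega>)"
    using eventually_ge_at_top[of 1]
    by eventually_elim (auto intro!: AE_I2 Lq_norm_cmult_le[OF q] U(2))
qed

section \<open>Gap between the optimal values at a fixed covariate\<close>

lemma optimal_value_gap:
  fixes S :: "'y::euclidean_space set" and G :: "'z \<Rightarrow> real"
  assumes n: "1 \<le> n" and S: "convex S" "closed S"
    and lip: "\<And>z. z \<in> Z \<Longrightarrow> l-lipschitz_on S (c z)"
    and c_meas: "\<And>z. z \<in> Z \<Longrightarrow> c z \<in> borel_measurable borel"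
    and PP: "PP \<subseteq> prob_vectors n" "\<And>p. p \<in> PP \<Longrightarrow> (\<Sum>i=1..n. (p i - 1 / real n)\<^sup>2) \<le> s\<^sup>2 / real n"
    and s: "0 \<le> s" and \<mu>: "0 \<le> \<mu>"
    and true: "\<And>i. i \<in> {1..n} \<Longrightarrow> f x + residual f d i \<in> S"
    and obj_def: "obj = worst_case_cost (ambiguity_set n S fh d PP \<mu> x) c"
    and obj_real: "\<And>z. z \<in> Z \<Longrightarrow> \<bar>obj z\<bar> \<noteq> \<infinity>"
    and z0: "is_arg_min obj (\<lambda>z. z \<in> Z) z0"
    and T_def: "T = ennreal l * (ennreal \<mu> + ennreal (norm (f x - fh x)) +
        ennreal ((1 + s) * sqrt (1 / real n * (\<Sum>i=1..n. (norm (f (snd (d i)) - fh (snd (d i))))\<^sup>2))))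
      + ennreal s * (SUP z\<in>Z. ennreal (sqrt ((1 / real n) * (\<Sum>i=1..n. (c z (f x + residual f d i))\<^sup>2))))
      + (SUP z\<in>Z. ennreal \<bar>full_info_cost n f d c z x - G z\<bar>)"
  shows "ennreal \<bar>min_value Z obj - min_value Z (\<lambda>z. ereal (G z))\<bar> \<le> ennreal 2 * T"
    and "ennreal \<bar>G z0 - min_value Z (\<lambda>z. ereal (G z))\<bar> \<le> ennreal 2 * T"
proof -
  have "ennreal \<bar>min_value Z obj - min_value Z (\<lambda>z. ereal (G z))\<bar> \<le> ennreal 2 * T \<and>
    ennreal \<bar>G z0 - min_value Z (\<lambda>z. ereal (G z))\<bar> \<le> ennreal 2 * T"
  \<comment> \<open>The bound \<open>T\<close> lives in [0,\<infinity>] since its suprema over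
    \<open>Z\<close> may be infinite, in which case both claims are trivial. Otherwise it is a real
    \<open>t\<close> that bounds the gap for all \<open>z\<close> and all distributions at
    once.\<close>
  proof (cases T)
    case top
    then show ?thesis by (simp add: ennreal_mult_top)
  next
    case (real t)
    have z0Z: "z0 \<in> Z" and z0_le: "\<And>z. z \<in> Z \<Longrightarrow> obj z0 \<le> obj z"
      using z0 by (auto simp: is_arg_min_def not_less)
    define w where "w = (1 + s) * sqrt (1 / real n * (\<Sum>i=1..n. (norm (f (snd (d i)) - fh (snd (d i))))\<^sup>2))"
    define b where "b = l * (\<mu> + norm (f x - fh x) + w)"
    define k where "k z = sqrt (1 / real n * (\<Sum>i=1..n. (c z (f x + residual f d i))\<^sup>2))" for z
    define e where "e z = \<bar>full_info_cost n f d c z x - G z\<bar>" for z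
    have l: "0 \<le> l" using lip[OF z0Z] by (rule lipschitz_on_nonneg)
    have w0: "0 \<le> w"
      unfolding w_def using s by (intro mult_nonneg_nonneg real_sqrt_ge_zero sum_nonneg) auto
    have b0: "0 \<le> b" unfolding b_def using l \<mu> w0 by simp
    have k0: "0 \<le> k z" for z unfolding k_def by (simp add: sum_nonneg)
    have total: "b + s * k z + e z \<le> t" if z: "z \<in> Z" for z
    proof -
      have "ennreal (b + s * k z + e z) = ennreal b + ennreal s * ennreal (k z) + ennreal (e z)"
        using b0 k0 s by (simp add: e_def ennreal_mult)
      also have "\<dots> \<le> ennreal b + ennreal s * (SUP z\<in>Z. ennreal (k z)) + (SUP z\<in>Z. ennreal (e z))"
        using z by (intro add_mono mult_left_mono SUP_upper) auto
      also have "\<dots> = T"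
        using l \<mu> w0 unfolding T_def w_def[symmetric] k_def[symmetric] e_def[symmetric] b_def
        by (simp add: ennreal_mult)
      finally show ?thesis using real by (simp add: ennreal_le_iff)
    qed
    have gap: "\<bar>(\<integral>y. c z y \<partial>Q) - G z\<bar> \<le> t" if z: "z \<in> Z" and Q: "Q \<in> ambiguity_set n S fh d PP \<mu> x" for z Q
    proof -
      obtain p ybar where pQ: "Q = weighted_diracs n p ybar" "p \<in> PP"
          "\<And>i. i \<in> {1..n} \<Longrightarrow> ybar i \<in> residual_ball S fh d x \<mu> i"
        using Q unfolding ambiguity_set_def by blast
      have "\<bar>(\<integral>y. c z y \<partial>Q) - full_info_cost n f d c z x\<bar> \<le> b + s * k z"
        unfolding pQ(1) b_def k_def w_def
        by (rule discrete_cost_gap) (use n S lip[OF z] c_meas[OF z] true s PP pQ in auto)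
      then show ?thesis using total[OF z] unfolding e_def by linarith
    qed
    \<comment> \<open>The lower bound on the worst case needs one admissible distribution. It exists
      because the supremum over an empty set is -\<infinity>, contrary to the objective being
      real-valued.\<close>
    obtain Q0 where Q0: "Q0 \<in> ambiguity_set n S fh d PP \<mu> x"
    proof (cases "ambiguity_set n S fh d PP \<mu> x = {}")
      case True
      then show ?thesis using obj_real[OF z0Z] by (simp add: obj_def worst_case_cost_def bot_ereal_def)
    qed (use that in blast)
    have upper: "obj z \<le> ereal (G z + t)" if z: "z \<in> Z" for z
      unfolding obj_def worst_case_cost_def
    proof (rule SUP_least)
      fix Q assume "Q \<in> ambiguity_set n S fh d PP \<mu> x"
      then show "ereal (\<integral>y. c z y \<partial>Q) \<le> ereal (G z + t)"
        using gap[OF z] by (simp add: abs_le_iff) (smt (verit))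
    qed
    have lower: "ereal (G z - t) \<le> obj z" if z: "z \<in> Z" for z
      unfolding obj_def worst_case_cost_def
      using gap[OF z Q0] by (intro SUP_upper2[OF Q0]) auto
    note pert = min_value_perturbation[where F = obj and G = G and t = t, OF z0Z z0_le obj_real[OF z0Z] upper lower]
    have "ennreal 2 * T = ennreal (2 * t)" using real by (simp add: ennreal_mult')
    then show ?thesis using pert real(2) by (auto intro!: ennreal_leI)
  qed
  then show "ennreal \<bar>min_value Z obj - min_value Z (\<lambda>z. ereal (G z))\<bar> \<le> ennreal 2 * T"
    "ennreal \<bar>G z0 - min_value Z (\<lambda>z. ereal (G z))\<bar> \<le> ennreal 2 * T" by auto
qed

section \<open>Sample errors shifted by the regression function stay in the support of
  \<open>Y\<close>\<close>

lemma (in prob_space) AE_shifted_error_in_support: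
  fixes X :: "'a \<Rightarrow> 'x::euclidean_space" and Y \<epsilon> :: "'a \<Rightarrow> 'y::euclidean_space"
  assumes [measurable]: "X \<in> borel_measurable M" "\<epsilon> \<in> borel_measurable M" "f \<in> borel_measurable borel"
      "Y \<in> borel_measurable M" and D[measurable]: "D \<in> M \<rightarrow>\<^sub>M borel \<Otimes>\<^sub>M borel"
    and model: "\<And>\<omega>. \<omega> \<in> space M \<Longrightarrow> Y \<omega> = f (X \<omega>) + \<epsilon> \<omega>"
    and indep: "indep_set {X -` A \<inter> space M | A. A \<in> sets borel} {\<epsilon> -` B \<inter> space M | B. B \<in> sets borel}"
    and D_distr: "distr M (borel \<Otimes>\<^sub>M borel) D = distr M (borel \<Otimes>\<^sub>M borel) (\<lambda>\<omega>. (Y \<omega>, X \<omega>))"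
  shows "AE \<omega> in M. AE x in distr M borel X.
    f x + (fst (D \<omega>) - f (snd (D \<omega>))) \<in> topological_support (distr M borel Y)"
proof -
  define S where "S = topological_support (distr M borel Y)"
  define PX where "PX = distr M borel X"
  define PE where "PE = distr M borel \<epsilon>"
  have [measurable]: "S \<in> sets borel"
    unfolding S_def by (intro borel_closed closed_topological_support)
  have sets_P [measurable_cong]: "sets PX = sets borel" "sets PE = sets borel"
    by (auto simp: PX_def PE_def)
  interpret PX: prob_space PX unfolding PX_def by (rule prob_space_distr) simp
  interpret PE: prob_space PE unfolding PE_def by (rule prob_space_distr) simp
  interpret pair_sigma_finite PX PE ..
  \<comment> \<open>Independence identifies the joint law of \<open>X\<close> and
    \<open>\<epsilon>\<close> with the product of their laws, by agreement on rectangles.\<close>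
  have joint: "PX \<Otimes>\<^sub>M PE = distr M (borel \<Otimes>\<^sub>M borel) (\<lambda>\<omega>. (X \<omega>, \<epsilon> \<omega>))"
  proof (rule pair_measure_eqI)
    fix A B assume "A \<in> sets PX" "B \<in> sets PE"
    then have A[measurable]: "A \<in> sets borel" and B[measurable]: "B \<in> sets borel"
      by (simp_all add: sets_P)
    have "prob ((X -` A \<inter> space M) \<inter> (\<epsilon> -` B \<inter> space M))
        = prob (X -` A \<inter> space M) * prob (\<epsilon> -` B \<inter> space M)"
      using A B by (intro indep_setD[OF indep]) auto
    moreover have "(\<lambda>\<omega>. (X \<omega>, \<epsilon> \<omega>)) -` (A \<times> B) \<inter> space M = (X -` A \<inter> space M) \<inter> (\<epsilon> -` B \<inter> space M)"
      by auto
    ultimately show "emeasure PX A * emeasure PE B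
        = emeasure (distr M (borel \<Otimes>\<^sub>M borel) (\<lambda>\<omega>. (X \<omega>, \<epsilon> \<omega>))) (A \<times> B)"
      unfolding PX_def PE_def by (simp add: emeasure_distr emeasure_eq_measure ennreal_mult)
  qed (unfold_locales, simp add: sets_pair_measure_cong[OF sets_P])
  have "AE y in distr M borel Y. y \<in> S"
    unfolding S_def by (rule AE_topological_support) simp
  then have "AE \<omega> in M. Y \<omega> \<in> S"
    by (rule AE_distrD[rotated]) simp
  then have "AE \<omega> in M. f (X \<omega>) + \<epsilon> \<omega> \<in> S"
    using AE_space by eventually_elim (simp add: model)
  then have "AE p in PX \<Otimes>\<^sub>M PE. f (fst p) + snd p \<in> S"
    unfolding joint by (subst AE_distr_iff) auto
  then have "AE x in PX. AE e in PE. f x + e \<in> S"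
    using AE_pair[of "\<lambda>p. f (fst p) + snd p \<in> S"] by simp
  \<comment> \<open>The quantifiers are exchanged so that the error comes first: it will be fixed by
    the data, and only then does \<open>x\<close> vary.\<close>
  then have AE_PE: "AE e in PE. AE x in PX. f x + e \<in> S"
    by (subst (asm) AE_commute) simp_all
  \<comment> \<open>The error is \<open>y - f x\<close> evaluated at \<open>(Y, X)\<close>. Since an
    observation has the law of \<open>(Y, X)\<close>, its error has the law of
    \<open>\<epsilon>\<close>, and the almost sure statement carries over to it.\<close>
  have "PE = distr (distr M (borel \<Otimes>\<^sub>M borel) (\<lambda>\<omega>. (Y \<omega>, X \<omega>))) borel (\<lambda>p. fst p - f (snd p))"
    unfolding PE_def by (subst distr_distr) (auto intro!: distr_cong simp: model)
  also have "\<dots> = distr M borel (\<lambda>\<omega>. fst (D \<omega>) - f (snd (D \<omega>)))"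
    unfolding D_distr[symmetric] by (subst distr_distr) (auto simp: comp_def)
  finally have PE_eq: "PE = distr M borel (\<lambda>\<omega>. fst (D \<omega>) - f (snd (D \<omega>)))" .
  have "AE e in distr M borel (\<lambda>\<omega>. fst (D \<omega>) - f (snd (D \<omega>))). AE x in PX. f x + e \<in> S"
    using AE_PE unfolding PE_eq .
  then show ?thesis
    unfolding S_def[symmetric] PX_def[symmetric] by (rule AE_distrD[rotated]) simp
qed

section \<open>Rate for the optimal value and the solution\<close>

theorem theorem18:
  fixes M :: "'w measure"
    and X :: "'w \<Rightarrow> 'x::euclidean_space"
    and Y \<epsilon> :: "'w \<Rightarrow> 'y::euclidean_space"
    and f :: "'x \<Rightarrow> 'y"
    and c :: "'z::euclidean_space \<Rightarrow> 'y \<Rightarrow> real"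
    and Z :: "'z set"
    and D :: "nat \<Rightarrow> 'w \<Rightarrow> 'y \<times> 'x"
    and reg :: "nat \<Rightarrow> (nat \<Rightarrow> 'y \<times> 'x) \<Rightarrow> 'x \<Rightarrow> 'y"
    and \<PP> :: "nat \<Rightarrow> 'x \<Rightarrow> real \<Rightarrow> (nat \<Rightarrow> real) set"
    and \<mu> \<zeta> :: "nat \<Rightarrow> 'x \<Rightarrow> real"
    and zhat :: "nat \<Rightarrow> 'w \<Rightarrow> 'x \<Rightarrow> 'z"
    and q :: ennreal and r :: real and L :: "'z \<Rightarrow> real"
    and PX :: "'x measure" and \<X> :: "'x set" and \<Y> :: "'y set"
    and data :: "nat \<Rightarrow> 'w \<Rightarrow> nat \<Rightarrow> 'y \<times> 'x"
    and fhat :: "nat \<Rightarrow> 'w \<Rightarrow> 'x \<Rightarrow> 'y"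
    and g :: "'z \<Rightarrow> 'x \<Rightarrow> real"
    and gstar :: "nat \<Rightarrow> 'w \<Rightarrow> 'z \<Rightarrow> 'x \<Rightarrow> real"
    and vstar :: "'x \<Rightarrow> real"
    and obj :: "nat \<Rightarrow> 'w \<Rightarrow> 'x \<Rightarrow> 'z \<Rightarrow> ereal"
    and vhat :: "nat \<Rightarrow> 'w \<Rightarrow> 'x \<Rightarrow> real"
  assumes PX_eq: "PX = distr M borel X"
    and X_supp_eq: "\<X> = topological_support PX"
    and Y_supp_eq: "\<Y> = topological_support (distr M borel Y)"
    and data_eq: "data = (\<lambda>n \<omega>. \<lambda>i\<in>{1..n}. D i \<omega>)"
    and fhat_eq: "fhat = (\<lambda>n \<omega>. reg n (data n \<omega>))"
    and g_eq: "g = expected_cost M \<epsilon> f c"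
    and gstar_eq: "gstar = (\<lambda>n \<omega>. full_info_cost n f (data n \<omega>) c)"
    and vstar_eq: "vstar = (\<lambda>x. min_value Z (\<lambda>z. ereal (g z x)))"
    and obj_eq: "obj = (\<lambda>n \<omega> x. worst_case_cost
          (ambiguity_set n \<Y> (fhat n \<omega>) (data n \<omega>) (\<PP> n x (\<zeta> n x)) (\<mu> n x) x) c)"
    and vhat_eq: "vhat = (\<lambda>n \<omega> x. min_value Z (obj n \<omega> x))"
    and prob: "prob_space M"
    and X_meas: "X \<in> borel_measurable M" and eps_meas: "\<epsilon> \<in> borel_measurable M"
    and Y_model: "\<forall>\<omega>\<in>space M. Y \<omega> = f (X \<omega>) + \<epsilon> \<omega>"
    and f_reg: "regression_function M X Y f"
    and eps_mean: "integrable M \<epsilon>" "(\<integral>\<omega>. \<epsilon> \<omega> \<partial>M) = 0"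
    and eps_indep: "prob_space.indep_set M {X -` A \<inter> space M | A. A \<in> sets borel}
          {\<epsilon> -` B \<inter> space M | B. B \<in> sets borel}"
    and Y_supp: "\<Y> \<noteq> {}" "convex \<Y>"
    and Z: "Z \<noteq> {}" "compact Z"
    and c_meas: "(\<lambda>(z, y). c z y) \<in> borel_measurable (borel \<Otimes>\<^sub>M borel)"
    and c_integrable: "\<forall>z\<in>Z. AE x in PX. integrable M (\<lambda>\<omega>. c z (f x + \<epsilon> \<omega>))"
    and g_lsc: "AE x in PX. lsc_on Z (\<lambda>z. ereal (g z x))"
    and vstar_meas: "vstar \<in> borel_measurable borel"
    and D_meas: "\<forall>i\<ge>1. D i \<in> M \<rightarrow>\<^sub>M borel \<Otimes>\<^sub>M borel"
    and D_distr: "\<forall>i\<ge>1. distr M (borel \<Otimes>\<^sub>M borel) (D i) =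
          distr M (borel \<Otimes>\<^sub>M borel) (\<lambda>\<omega>. (Y \<omega>, X \<omega>))"
    and reg_meas: "\<forall>n\<ge>1. (\<lambda>(d, x). reg n d x) \<in>
          borel_measurable ((\<Pi>\<^sub>M i\<in>{1..n}. borel \<Otimes>\<^sub>M borel) \<Otimes>\<^sub>M borel)"
    and mu: "\<forall>n\<ge>1. \<mu> n \<in> borel_measurable borel" "\<forall>n\<ge>1. \<forall>x\<in>\<X>. 0 \<le> \<mu> n x"
    and zeta: "\<forall>n\<ge>1. \<zeta> n \<in> borel_measurable borel" "\<forall>n\<ge>1. \<forall>x\<in>\<X>. 0 \<le> \<zeta> n x"
    and PP_prob: "\<forall>n\<ge>1. \<forall>x\<in>\<X>. \<forall>t\<ge>0. \<PP> n x t \<subseteq> prob_vectors n"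
    and PP_zero: "\<forall>n\<ge>1. \<forall>x\<in>\<X>. \<PP> n x 0 = {\<lambda>i\<in>{1..n}. 1 / real n}"
    and PP_lim: "\<forall>n\<ge>1. \<forall>x\<in>\<X>. set_limit (\<PP> n x) (\<PP> n x 0) (at_right 0)"
    and obj_real: "\<forall>n\<ge>1. \<forall>\<omega>\<in>space M. \<forall>x\<in>\<X>. \<forall>z\<in>Z. \<bar>obj n \<omega> x z\<bar> \<noteq> \<infinity>"
    and obj_lsc: "\<forall>n\<ge>1. \<forall>\<omega>\<in>space M. \<forall>x\<in>\<X>. lsc_on Z (obj n \<omega> x)"
    and vhat_meas: "\<forall>n\<ge>1. (\<lambda>(\<omega>, x). vhat n \<omega> x) \<in> borel_measurable (M \<Otimes>\<^sub>M borel)"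
    and zhat_meas: "\<forall>n\<ge>1. (\<lambda>(\<omega>, x). zhat n \<omega> x) \<in> borel_measurable (M \<Otimes>\<^sub>M borel)"
    and zhat_opt: "\<forall>n\<ge>1. \<forall>\<omega>\<in>space M. \<forall>x\<in>\<X>.
          is_arg_min (obj n \<omega> x) (\<lambda>z. z \<in> Z) (zhat n \<omega> x)"
    and q: "1 \<le> q"
    and i_lipschitz: "\<forall>z\<in>Z. lipschitz_on (L z) \<Y> (c z)" "bdd_above (L ` Z)"
    and r: "0 < r" "r \<le> 1"
    and ii_norm: "big_O_p M (\<lambda>n \<omega>. Lq_norm q PX (\<lambda>x. ennreal (norm (f x - fhat n \<omega> x))))
          (\<lambda>n. real n powr (- r / 2))"
    and ii_mse: "big_O_p M (\<lambda>n \<omega>. ennreal ((1 / real n) *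
            (\<Sum>i=1..n. (norm (f (snd (D i \<omega>)) - fhat n \<omega> (snd (D i \<omega>))))\<^sup>2)))
          (\<lambda>n. real n powr (- r))"
    and iii_cost_meas: "\<forall>n\<ge>1. (\<lambda>(\<omega>, x). SUP z\<in>Z. ennreal (sqrt ((1 / real n) *
            (\<Sum>i=1..n. (c z (f x + residual f (data n \<omega>) i))\<^sup>2)))) \<in> borel_measurable (M \<Otimes>\<^sub>M borel)"
    and iii_cost: "big_O_p M (\<lambda>n \<omega>. Lq_norm q PX (\<lambda>x. SUP z\<in>Z. ennreal (sqrt ((1 / real n) *
            (\<Sum>i=1..n. (c z (f x + residual f (data n \<omega>) i))\<^sup>2)))))
          (\<lambda>n. 1)"
    and iii_dev_meas: "\<forall>n\<ge>1. (\<lambda>(\<omega>, x). SUP z\<in>Z. ennreal \<bar>gstar n \<omega> z x - g z x\<bar>)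
          \<in> borel_measurable (M \<Otimes>\<^sub>M borel)"
    and iii_dev: "big_O_p M (\<lambda>n \<omega>. Lq_norm q PX (\<lambda>x. SUP z\<in>Z. ennreal \<bar>gstar n \<omega> z x - g z x\<bar>))
          (\<lambda>n. real n powr (- 1 / 2))"
    and iv_zeta: "big_O (\<lambda>n. SUP x\<in>\<X>. SUP p\<in>\<PP> n x (\<zeta> n x).
            ennreal (\<Sum>i=1..n. (p i - 1 / real n)\<^sup>2))
          (\<lambda>n. real n powr (- (1 + r)))"
    and iv_mu: "big_O (\<lambda>n. Lq_norm q PX (\<lambda>x. ennreal (\<mu> n x))) (\<lambda>n. real n powr (- r / 2))"
  shows "big_O_p M (\<lambda>n \<omega>. Lq_norm q PX (\<lambda>x. ennreal \<bar>vhat n \<omega> x - vstar x\<bar>))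
           (\<lambda>n. real n powr (- r / 2)) \<and>
         big_O_p M (\<lambda>n \<omega>. Lq_norm q PX (\<lambda>x. ennreal \<bar>g (zhat n \<omega> x) x - vstar x\<bar>))
           (\<lambda>n. real n powr (- r / 2))"
proof -
  interpret prob_space M by fact
  interpret PX: prob_space PX unfolding PX_eq using X_meas by (rule prob_space_distr)
  have sets_PX [measurable_cong]: "sets PX = sets borel" by (simp add: PX_eq)
  have f_meas [measurable]: "f \<in> borel_measurable borel"
    using f_reg by (simp add: regression_function_def)
  have Y_meas: "Y \<in> borel_measurable M"
    using f_reg unfolding regression_function_def by (auto intro: borel_measurable_integrable)
  have S: "convex \<Y>" "closed \<Y>"
    using Y_supp by (auto simp: Y_supp_eq closed_topological_support)
  have data_eval: "data n \<omega> i = D i \<omega>" if "i \<in> {1..n}" for n \<omega> i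
    using that by (simp add: data_eq)
  define e where "e = (\<lambda>n::nat. real n powr (- r / 2))"
  \<comment> \<open>At index \<open>0\<close> the rate is zero, because \<open>0 powr a\<close> is
    \<open>0\<close>; positivity starts at \<open>1\<close>.\<close>
  have e_pos: "0 < e n" if "1 \<le> n" for n using that by (simp add: e_def)
  have e_nonneg: "0 \<le> e n" for n by (simp add: e_def)

  obtain l where l_bound: "\<And>z. z \<in> Z \<Longrightarrow> L z \<le> l"
    using i_lipschitz(2) by (auto simp: bdd_above_def)
  have lip: "l-lipschitz_on \<Y> (c z)" if "z \<in> Z" for z
    using i_lipschitz(1) l_bound[OF that] that by (auto intro: lipschitz_on_le)
  have l: "0 \<le> l" using lip Z(1) lipschitz_on_nonneg by blast

  obtain C0 where C0: "\<forall>\<^sub>F n in sequentially. (SUP x\<in>\<X>. SUP p\<in>\<PP> n x (\<zeta> n x).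
      ennreal (\<Sum>i=1..n. (p i - 1 / real n)\<^sup>2)) \<le> ennreal (C0 * real n powr (- (1 + r)))"
    using iv_zeta unfolding big_O_def by blast
  define C where "C = max C0 0"
  \<comment> \<open>Chosen so that \<open>(s n)\<^sup>2 / real n\<close> equals the bound
    \<open>C * real n powr (- (1 + r))\<close> on the squared weight deviations, the form that the
    Cauchy-Schwarz estimate takes; \<open>s n\<close> is then of the target order.\<close>
  define s where "s = (\<lambda>n. sqrt C * e n)"
  have C: "0 \<le> C" "C0 \<le> C" by (auto simp: C_def)
  have s_nonneg: "0 \<le> s n" for n using C by (simp add: s_def e_nonneg)
  have s_square: "(s n)\<^sup>2 / real n = C * real n powr (- (1 + r))" if "1 \<le> n" for n
  proof -
    have "(e n)\<^sup>2 = real n powr (- r)"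
      unfolding e_def power2_eq_square by (simp flip: powr_add)
    moreover have "real n powr (- (1 + r)) = real n powr (- r) / real n"
      using that powr_add[of "real n" "- r" "- 1"] powr_minus_divide[of "real n" 1]
      by (simp add: algebra_simps)
    ultimately show ?thesis using C by (simp add: s_def power_mult_distrib)
  qed
  have weights: "\<forall>\<^sub>F n in sequentially. \<forall>x\<in>\<X>. \<forall>p\<in>\<PP> n x (\<zeta> n x).
      (\<Sum>i=1..n. (p i - 1 / real n)\<^sup>2) \<le> (s n)\<^sup>2 / real n"
    using C0 eventually_ge_at_top[of 1]
  proof eventually_elim
    case (elim n)
    show ?case
    proof (intro ballI)
      fix x p assume "x \<in> \<X>" "p \<in> \<PP> n x (\<zeta> n x)"
      then have "ennreal (\<Sum>i=1..n. (p i - 1 / real n)\<^sup>2) \<le>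
          (SUP x\<in>\<X>. SUP p\<in>\<PP> n x (\<zeta> n x). ennreal (\<Sum>i=1..n. (p i - 1 / real n)\<^sup>2))"
        by (intro SUP_upper2[of x] SUP_upper)
      also have "\<dots> \<le> ennreal (C * real n powr (- (1 + r)))"
        using elim(1) C by (elim order_trans) (intro ennreal_leI mult_right_mono, auto)
      finally show "(\<Sum>i=1..n. (p i - 1 / real n)\<^sup>2) \<le> (s n)\<^sup>2 / real n"
        using C by (simp add: s_square[OF elim(2)] ennreal_le_iff)
    qed
  qed

  \<comment> \<open>The dominating function \<open>T\<close>\<close>
  define m where "m n \<omega> = sqrt (1 / real n *
      (\<Sum>i=1..n. (norm (f (snd (D i \<omega>)) - fhat n \<omega> (snd (D i \<omega>))))\<^sup>2))" for n \<omega>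
  define H where "H n \<omega> x = (SUP z\<in>Z. ennreal (sqrt ((1 / real n) *
      (\<Sum>i=1..n. (c z (f x + residual f (data n \<omega>) i))\<^sup>2))))" for n \<omega> x
  define V where "V n \<omega> x = (SUP z\<in>Z. ennreal \<bar>gstar n \<omega> z x - g z x\<bar>)" for n \<omega> x
  \<comment> \<open>This is the bound of \<open>optimal_value_gap\<close> at stage \<open>n\<close>:
    \<open>m\<close> is the root mean squared prediction error on the sample, \<open>H\<close> the
    worst quadratic mean of the costs, \<open>V\<close> the worst deviation of the sample average
    from \<open>g\<close>.\<close>
  define T where "T n \<omega> x = ennreal l * (ennreal (\<mu> n x) + ennreal (norm (f x - fhat n \<omega> x)) +
      ennreal ((1 + s n) * m n \<omega>)) + ennreal (s n) * H n \<omega> x + V n \<omega> x" for n \<omega> x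

  have mu_meas [measurable]: "\<mu> n \<in> borel_measurable PX" if "1 \<le> n" for n
    using mu(1) that measurable_cong_sets[OF sets_PX refl] by blast
  have fhat_meas [measurable]: "fhat n \<omega> \<in> borel_measurable PX" if "1 \<le> n" "\<omega> \<in> space M" for n \<omega>
  proof -
    have "data n \<omega> \<in> space (\<Pi>\<^sub>M i\<in>{1..n}. borel \<Otimes>\<^sub>M borel)"
      by (auto simp: data_eq space_PiM space_pair_measure)
    from measurable_Pair2[OF reg_meas[rule_format, OF that(1)] this]
    have "fhat n \<omega> \<in> borel_measurable borel" by (simp add: fhat_eq)
    then show ?thesis by simp
  qed
  have H_meas [measurable]: "H n \<omega> \<in> borel_measurable PX" if "1 \<le> n" "\<omega> \<in> space M" for n \<omega>
    using measurable_Pair2[OF iii_cost_meas[rule_format, OF that(1)] that(2)] by (simp add: H_def[abs_def])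
  have V_meas [measurable]: "V n \<omega> \<in> borel_measurable PX" if "1 \<le> n" "\<omega> \<in> space M" for n \<omega>
    using measurable_Pair2[OF iii_dev_meas[rule_format, OF that(1)] that(2)] by (simp add: V_def[abs_def])
  have parts_meas: "(\<lambda>x. ennreal (\<mu> n x)) \<in> borel_measurable PX"
      "(\<lambda>x. ennreal (norm (f x - fhat n \<omega> x))) \<in> borel_measurable PX"
      "(\<lambda>x. ennreal (s n) * H n \<omega> x) \<in> borel_measurable PX" if "1 \<le> n" "\<omega> \<in> space M" for n \<omega>
    using that by (measurable, measurable, measurable)
  have T_meas: "T n \<omega> \<in> borel_measurable PX" if "1 \<le> n" "\<omega> \<in> space M" for n \<omega>
    unfolding T_def using that by measurable

  \<comment> \<open>Rate of the dominating function\<close>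
  have tail_m: "tail_bounded M (\<lambda>n \<omega>. ennreal (m n \<omega>)) e"
  proof -
    have "sqrt (real n powr (- r)) = e n" for n :: nat
      by (cases "n = 0") (simp_all add: e_def powr_half_sqrt[symmetric] powr_powr)
    then show ?thesis
      using tail_bounded_sqrt[OF big_O_p_imp_tail_bounded[OF ii_mse]] by (simp add: m_def)
  qed
  \<comment> \<open>The norm of \<open>H\<close> is merely bounded in probability; the rate comes
    from the factor \<open>e n\<close> contained in \<open>s n\<close>.\<close>
  have tail_H: "tail_bounded M (\<lambda>n \<omega>. ennreal (e n) * Lq_norm q PX (H n \<omega>)) e"
  proof -
    have "tail_bounded M (\<lambda>n \<omega>. Lq_norm q PX (H n \<omega>)) (\<lambda>n. 1)"
      using big_O_p_imp_tail_bounded[OF iii_cost] unfolding H_def[abs_def] .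
    from tail_bounded_scale[OF this e_nonneg] show ?thesis by simp
  qed
  have tail_T: "tail_bounded M (\<lambda>n \<omega>. Lq_norm q PX (T n \<omega>)) e"
    unfolding T_def
  proof (intro tail_bounded_Lq_add tail_bounded_Lq_cmult q l finite_measure_axioms e_nonneg)
    show "tail_bounded M (\<lambda>n \<omega>. Lq_norm q PX (\<lambda>x. ennreal (\<mu> n x))) e"
      using iv_mu e_nonneg unfolding e_def by (rule big_O_imp_tail_bounded)
    show "tail_bounded M (\<lambda>n \<omega>. Lq_norm q PX (\<lambda>x. ennreal (norm (f x - fhat n \<omega> x)))) e"
      using ii_norm unfolding e_def by (rule big_O_p_imp_tail_bounded)
    \<comment> \<open>This term is constant in \<open>x\<close>, so on a probability space its norm
      is at most its value. From \<open>e n \<le> 1\<close> the factor \<open>1 + s n\<close> is at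
      most \<open>1 + sqrt C\<close>.\<close>
    show "tail_bounded M (\<lambda>n \<omega>. Lq_norm q PX (\<lambda>x. ennreal ((1 + s n) * m n \<omega>))) e"
    proof (rule tail_bounded_dominated[OF finite_measure_axioms tail_m, of "1 + sqrt C"])
      show "\<forall>\<^sub>F n in sequentially. AE \<omega> in M. Lq_norm q PX (\<lambda>x. ennreal ((1 + s n) * m n \<omega>))
          \<le> ennreal (1 + sqrt C) * ennreal (m n \<omega>)"
        using eventually_ge_at_top[of 1]
      proof eventually_elim
        case (elim n)
        have "e n \<le> 1"
          using elim r powr_mono[of "- r / 2" 0 "real n"] by (simp add: e_def)
        then have "s n \<le> sqrt C"
          using C mult_left_mono[of "e n" 1 "sqrt C"] by (simp add: s_def)
        moreover have "0 \<le> m n \<omega>" for \<omega> by (simp add: m_def sum_nonneg)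
        ultimately have "(1 + s n) * m n \<omega> \<le> (1 + sqrt C) * m n \<omega>" for \<omega>
          by (intro mult_right_mono) auto
        then have "ennreal ((1 + s n) * m n \<omega>) \<le> ennreal (1 + sqrt C) * ennreal (m n \<omega>)" for \<omega>
          using C by (subst ennreal_mult'[symmetric]) (auto intro: ennreal_leI)
        then show ?case
          using Lq_norm_const_le[OF PX.prob_space_axioms q] order_trans by (intro AE_I2) blast
      qed
    qed (use C in simp)
    show "tail_bounded M (\<lambda>n \<omega>. Lq_norm q PX (\<lambda>x. ennreal (s n) * H n \<omega> x)) e"
    proof (rule tail_bounded_dominated[OF finite_measure_axioms tail_H, of "sqrt C"])
      show "\<forall>\<^sub>F n in sequentially. AE \<omega> in M. Lq_norm q PX (\<lambda>x. ennreal (s n) * H n \<omega> x)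
          \<le> ennreal (sqrt C) * (ennreal (e n) * Lq_norm q PX (H n \<omega>))"
        using eventually_ge_at_top[of 1]
      proof eventually_elim
        case (elim n)
        then show ?case
          using Lq_norm_cmult_le[OF q H_meas, of n _ "ennreal (s n)"] C e_nonneg
          by (intro AE_I2) (simp add: s_def ennreal_mult mult.assoc)
      qed
    qed (use C in simp)
    \<comment> \<open>The sampling rate \<open>n powr (- 1 / 2)\<close> is at least as fast as
      \<open>e n\<close> because \<open>r \<le> 1\<close>.\<close>
    show "tail_bounded M (\<lambda>n \<omega>. Lq_norm q PX (V n \<omega>)) e"
    proof (rule tail_bounded_rate_mono)
      show "tail_bounded M (\<lambda>n \<omega>. Lq_norm q PX (V n \<omega>)) (\<lambda>n. real n powr (- 1 / 2))"
        using big_O_p_imp_tail_bounded[OF iii_dev] by (simp add: V_def[abs_def])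
      show "real n powr (- 1 / 2) \<le> e n" if "1 \<le> n" for n
        unfolding e_def using that r by (intro powr_mono) auto
    qed
  qed (assumption | rule parts_meas V_meas borel_measurable_const borel_measurable_add
      borel_measurable_times_ennreal)+

  \<comment> \<open>Almost sure comparison with the dominating function\<close>
  have supp: "AE \<omega> in M. AE x in PX. \<forall>i\<in>{1..n}. f x + residual f (data n \<omega>) i \<in> \<Y>" for n
  proof -
    have "AE \<omega> in M. AE x in PX. f x + residual f (data n \<omega>) i \<in> \<Y>" if i: "i \<in> {1..n}" for i
      using AE_shifted_error_in_support[OF X_meas eps_meas f_meas Y_meas _ _ eps_indep, of "D i"]
        D_meas D_distr Y_model i
      unfolding PX_eq Y_supp_eq by (simp add: residual_def data_eval[OF i])
    \<comment> \<open>For fixed \<open>n\<close> there are only finitely many indices, so their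
      exceptional sets can be merged, first in the data and then in \<open>x\<close>.\<close>
    then have "AE \<omega> in M. \<forall>i\<in>{1..n}. AE x in PX. f x + residual f (data n \<omega>) i \<in> \<Y>"
      by (intro AE_finite_allI) auto
    then show ?thesis by (rule eventually_mono) (auto intro: AE_finite_allI)
  qed
  have X_supp: "AE x in PX. x \<in> \<X>"
    unfolding X_supp_eq by (rule AE_topological_support) (rule sets_PX)
  have c_meas1: "c z \<in> borel_measurable borel" for z
    using measurable_Pair2[OF c_meas, of z] by simp

  \<comment> \<open>The bound holds for large \<open>n\<close>, where the weight bound is valid, for
    almost all data, and then off a null set of \<open>x\<close> that may depend on the data. This
    suffices since only norms over \<open>x\<close> are compared.\<close>
  have gap: "\<forall>\<^sub>F n in sequentially. AE \<omega> in M. AE x in PX.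
      ennreal \<bar>vhat n \<omega> x - vstar x\<bar> \<le> ennreal 2 * T n \<omega> x \<and>
      ennreal \<bar>g (zhat n \<omega> x) x - vstar x\<bar> \<le> ennreal 2 * T n \<omega> x"
    using weights eventually_ge_at_top[of 1]
  proof eventually_elim
    case (elim n)
    show ?case using supp[of n] AE_space
    proof eventually_elim
      case (elim \<omega>)
      note \<omega> = elim
      show ?case using \<omega>(1) X_supp
      proof eventually_elim
        case (elim x)
        have m_data: "m n \<omega> = sqrt (1 / real n * (\<Sum>i=1..n.
            (norm (f (snd (data n \<omega> i)) - fhat n \<omega> (snd (data n \<omega> i))))\<^sup>2))"
          unfolding m_def by (intro arg_cong[where f = sqrt] arg_cong2[where f = "(*)"] sum.cong refl)
            (simp add: data_eval)
        have T: "T n \<omega> x = ennreal l * (ennreal (\<mu> n x) + ennreal (norm (f x - fhat n \<omega> x)) +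
            ennreal ((1 + s n) * sqrt (1 / real n * (\<Sum>i=1..n.
              (norm (f (snd (data n \<omega> i)) - fhat n \<omega> (snd (data n \<omega> i))))\<^sup>2))))
          + ennreal (s n) * (SUP z\<in>Z. ennreal (sqrt ((1 / real n) * (\<Sum>i=1..n. (c z (f x + residual f (data n \<omega>) i))\<^sup>2))))
          + (SUP z\<in>Z. ennreal \<bar>full_info_cost n f (data n \<omega>) c z x - g z x\<bar>)"
          unfolding T_def m_data H_def V_def gstar_eq ..
        have obj: "obj n \<omega> x = worst_case_cost
            (ambiguity_set n \<Y> (fhat n \<omega>) (data n \<omega>) (\<PP> n x (\<zeta> n x)) (\<mu> n x) x) c"
          by (simp add: obj_eq)
        have PP: "\<PP> n x (\<zeta> n x) \<subseteq> prob_vectors n"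
          using PP_prob zeta(2) \<open>1 \<le> n\<close> \<open>x \<in> \<X>\<close> by blast
        have wts: "\<And>p. p \<in> \<PP> n x (\<zeta> n x) \<Longrightarrow> (\<Sum>i=1..n. (p i - 1 / real n)\<^sup>2) \<le> (s n)\<^sup>2 / real n"
          using \<open>\<forall>x\<in>\<X>. _\<close> \<open>x \<in> \<X>\<close> by blast
        have real: "\<And>z. z \<in> Z \<Longrightarrow> \<bar>obj n \<omega> x z\<bar> \<noteq> \<infinity>"
          using obj_real[rule_format, OF \<open>1 \<le> n\<close> \<omega>(2) \<open>x \<in> \<X>\<close>] .
        have opt: "is_arg_min (obj n \<omega> x) (\<lambda>z. z \<in> Z) (zhat n \<omega> x)"
          using zhat_opt \<open>1 \<le> n\<close> \<omega>(2) \<open>x \<in> \<X>\<close> by blast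
        have mu0: "0 \<le> \<mu> n x" using mu(2) \<open>1 \<le> n\<close> \<open>x \<in> \<X>\<close> by blast
        have true: "\<And>i. i \<in> {1..n} \<Longrightarrow> f x + residual f (data n \<omega>) i \<in> \<Y>"
          using elim(1) by blast
        show ?case
          using optimal_value_gap[where f = f and c = c and G = "\<lambda>z. g z x" and d = "data n \<omega>"
              and fh = "fhat n \<omega>" and x = x and obj = "obj n \<omega> x", OF \<open>1 \<le> n\<close> S lip c_meas1 PP wts s_nonneg mu0 true obj real opt T]
          by (simp add: vhat_eq vstar_eq)
      qed
    qed
  qed

  \<comment> \<open>Transfer of the rate to both claims\<close>
  have conclude: "big_O_p M (\<lambda>n \<omega>. Lq_norm q PX (U n \<omega>)) e"
    if U_meas: "\<And>n. 1 \<le> n \<Longrightarrow> (\<lambda>(\<omega>, x). U n \<omega> x) \<in> borel_measurable (M \<Otimes>\<^sub>M borel)"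
      and U_le: "\<forall>\<^sub>F n in sequentially. AE \<omega> in M. AE x in PX. U n \<omega> x \<le> ennreal 2 * T n \<omega> x"
    for U :: "nat \<Rightarrow> 'w \<Rightarrow> 'x \<Rightarrow> ennreal"
  proof (rule tail_bounded_imp_big_O_p[OF finite_measure_axioms _ e_pos])
    show "(\<lambda>\<omega>. Lq_norm q PX (U n \<omega>)) \<in> borel_measurable M" if "1 \<le> n" for n
      using U_meas[OF that] measurable_cong_sets[OF sets_pair_measure_cong[OF refl sets_PX] refl]
      by (intro measurable_Lq_norm PX.sigma_finite_measure_axioms) blast
    show "tail_bounded M (\<lambda>n \<omega>. Lq_norm q PX (U n \<omega>)) e"
    \<comment> \<open>The constant \<open>2\<close> is the one of the pointwise bound; domination
      almost everywhere in \<open>x\<close> passes to the norms.\<close>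
    proof (rule tail_bounded_dominated[OF finite_measure_axioms tail_T, of 2])
      show "\<forall>\<^sub>F n in sequentially. AE \<omega> in M. Lq_norm q PX (U n \<omega>) \<le> ennreal 2 * Lq_norm q PX (T n \<omega>)"
        using U_le eventually_ge_at_top[of 1]
      proof eventually_elim
        case (elim n)
        show ?case using elim(1) AE_space
        proof eventually_elim
          case (elim \<omega>)
          have "U n \<omega> \<in> borel_measurable PX"
            using measurable_Pair2[OF U_meas[OF \<open>1 \<le> n\<close>] elim(2)] by simp
          then have "Lq_norm q PX (U n \<omega>) \<le> Lq_norm q PX (\<lambda>x. ennreal 2 * T n \<omega> x)"
            using elim(1) by (rule Lq_norm_mono_AE)
          also have "\<dots> \<le> ennreal 2 * Lq_norm q PX (T n \<omega>)"
            using T_meas[OF \<open>1 \<le> n\<close> elim(2)] by (rule Lq_norm_cmult_le[OF q])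
          finally show ?case .
        qed
      qed
    qed simp
  qed

  \<comment> \<open>Joint measurability of \<open>g\<close> is required because the random solution
    is inserted into its first argument. It follows from measurability of an integral in its
    parameters.\<close>
  have g_meas: "(\<lambda>(z, x). g z x) \<in> borel_measurable (borel \<Otimes>\<^sub>M borel)"
  proof -
    have "(\<lambda>(p, \<omega>). c (fst p) (f (snd p) + \<epsilon> \<omega>)) \<in> borel_measurable ((borel \<Otimes>\<^sub>M borel) \<Otimes>\<^sub>M M)"
      using measurable_compose[OF _ c_meas, of "\<lambda>(p, \<omega>). (fst p, f (snd p) + \<epsilon> \<omega>)"] eps_meas
      by (simp add: case_prod_beta)
    then have "(\<lambda>p. \<integral>\<omega>. c (fst p) (f (snd p) + \<epsilon> \<omega>) \<partial>M) \<in> borel_measurable (borel \<Otimes>\<^sub>M borel)"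
      by (rule borel_measurable_lebesgue_integral)
    then show ?thesis by (simp add: g_eq expected_cost_def case_prod_beta)
  qed
  show ?thesis
    unfolding e_def[symmetric]
  proof (intro conjI conclude)
    fix n :: nat assume n: "1 \<le> n"
    note [measurable] = vhat_meas[rule_format, OF n] zhat_meas[rule_format, OF n] vstar_meas
    show "(\<lambda>(\<omega>, x). ennreal \<bar>vhat n \<omega> x - vstar x\<bar>) \<in> borel_measurable (M \<Otimes>\<^sub>M borel)"
      by measurable
    have [measurable]: "(\<lambda>(\<omega>, x). g (zhat n \<omega> x) x) \<in> borel_measurable (M \<Otimes>\<^sub>M borel)"
      using measurable_compose[OF _ g_meas, of "\<lambda>(\<omega>, x). (zhat n \<omega> x, x)"] by (simp add: case_prod_beta)
    show "(\<lambda>(\<omega>, x). ennreal \<bar>g (zhat n \<omega> x) x - vstar x\<bar>) \<in> borel_measurable (M \<Otimes>\<^sub>M borel)"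
      by measurable
  qed (use gap in \<open>auto elim!: eventually_mono\<close>)
qed

end
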